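(* Let $p$ be an NC polynomial, written as an NC Szeg\"o kernel $p=K\{Z,y,v\}$ (with $Z\in\mathbb{B}^d_n$, $y,v\in\mathbb{C}^n$ for some $n\in\mathbb{N}$), and let $p=\Theta\cdot f$ be its NC inner-outer factorization. Then $f=q$ is an NC polynomial of degree $\deg(q)\le\deg(p)$, and $\Theta(X)=p(X)q(X)^{-1}$ ($X\in\mathbb{B}^d_{\mathbb{N}}$) is an inner NC rational function. The inner factor of $p$ is NC Blaschke.
   Context: Fock space. Fix an integer $d\ge1$. $\mathbb{F}^d$ is the free monoid of words in the letters $1,\dots,d$; for $\alpha=i_1\cdots i_n$ put $|\alpha|=n$, $\mathfrak{z}^\alpha=\mathfrak{z}_{i_1}\cdots\mathfrak{z}_{i_n}$, $X^\alpha=X_{i_1}\cdots X_{i_n}$. $\mathbb{H}^2_d$ is the Hilbert space of formal power series $f=\sum_\alpha\hat f_\alpha\mathfrak{z}^\alpha$ in noncommuting variables with $\sum_\alpha|\hat f_\alpha|^2<\infty$, with inner product $\langle f,g\rangle=\sum_\alpha\overline{\hat f_\alpha}\hat g_\alpha$; NC polynomials are the finite sums, and the degree is the maximal $|\alpha|$ with $\hat f_\alpha\ne0$. $L_k,R_k$ are left, right multiplication by $\mathfrak{z}_k$. $\mathbb{B}^d_n$ is the set of $d$-tuples $X$ of $n\times n$ complex matrices with $\|\sum_jX_jX_j^*\|<1$; $\mathbb{B}^d_\infty$ is the set of such strict row contractions on a fixed separable infinite-dimensional Hilbert space (denoted $\mathbb{C}^\infty$); $\mathbb{B}^d_{\mathbb{N}}=\bigsqcup_{n\in\mathbb{N}}\mathbb{B}^d_n$.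 For $Z$ in any of these, $f(Z)=\sum_{k\ge0}\sum_{|\alpha|=k}\hat f_\alpha Z^\alpha$. For $Z\in\mathbb{B}^d_n$, $y,v\in\mathbb{C}^n$, $K\{Z,y,v\}\in\mathbb{H}^2_d$ is the unique vector with $\langle K\{Z,y,v\},f\rangle=y^*f(Z)v$ for all $f\in\mathbb{H}^2_d$; every NC polynomial is known to be of this form. $\mathbb{H}^\infty_d$ is the WOT-closed unital algebra generated by $L_1,\dots,L_d$, identified via $F(L)\mapsto F=F(L)1$ with the left multipliers of $\mathbb{H}^2_d$. Inner-outer. $\Theta\in\mathbb{H}^\infty_d$ is inner if $\Theta(L)$ is an isometry; $f\in\mathbb{H}^2_d$ is outer if the closed span of $\{R^\alpha f\}_\alpha$ is $\mathbb{H}^2_d$. Every nonzero $h\in\mathbb{H}^2_d$ factors as $h=\Theta(L)f$ with $\Theta$ inner and $f$ outer, uniquely up to a unimodular constant; this is its NC inner-outer factorization. For $f\in\mathbb{H}^2_d$, $\mathrm{Sing}_n(f)=\{(Z,y)\in\mathbb{B}^d_n\times(\mathbb{C}^n\setminus\{0\}):y^*f(Z)=0\}$ and $\mathrm{Sing}(f)=\bigsqcup_{n\in\mathbb{N}\cup\{\infty\}}\mathrm{Sing}_n(f)$. An inner $\Theta$ is NC Blaschke if $\mathrm{Ran}(\Theta(L))=\{h\in\mathbb{H}^2_d: y^*h(Z)=0\ \forall(Z,y)\in\mathrm{Sing}(\Theta)\}$. An NC rational function is an equivalence class of syntactically valid expressions (with nonempty domain) built from $\mathfrak{z}_1,\dots,\mathfrak{z}_d$,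 complex scalars, $+,\cdot,{}^{-1}$ and parentheses, two being equivalent if their domains (sets of matrix $d$-tuples of all finite sizes where they can be evaluated) intersect and they agree on the intersection; one regular at $0$ is identified with its power series at $0$. *)

theory Defs
  imports
    "HOL-Analysis.Analysis"
    "Jordan_Normal_Form.Gauss_Jordan_Elimination"
    "Jordan_Normal_Form.Schur_Decomposition"
begin

section \<open>The Hilbert space of square-summable families\<close>

definition sq_summable :: "('i \<Rightarrow> complex) \<Rightarrow> bool" where
  "sq_summable f \<longleftrightarrow> (\<lambda>i. (cmod (f i))\<^sup>2) summable_on UNIV"

lemma sq_summable_0: "sq_summable (\<lambda>_. 0)"
  by (simp add: sq_summable_def)

lemma sq_summable_mult: "sq_summable f \<Longrightarrow> sq_summable (\<lambda>i. c * f i)"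
  unfolding sq_summable_def by (simp add: norm_mult power_mult_distrib summable_on_cmult_right)

lemma sq_summable_add:
  assumes "sq_summable f" "sq_summable g"
  shows "sq_summable (\<lambda>i. f i + g i)"
proof -
  have "(\<lambda>i. 2 * (cmod (f i))\<^sup>2 + 2 * (cmod (g i))\<^sup>2) summable_on UNIV"
    using assms unfolding sq_summable_def by (intro summable_on_add summable_on_cmult_right)
  moreover have "(cmod (f i + g i))\<^sup>2 \<le> 2 * (cmod (f i))\<^sup>2 + 2 * (cmod (g i))\<^sup>2" for i
  proof -
    have "(cmod (f i + g i))\<^sup>2 \<le> (cmod (f i) + cmod (g i))\<^sup>2"
      by (intro power_mono norm_triangle_ineq) auto
    also have "\<dots> \<le> 2 * (cmod (f i))\<^sup>2 + 2 * (cmod (g i))\<^sup>2"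
      using zero_le_power2[of "cmod (f i) - cmod (g i)"] unfolding power2_sum power2_diff by linarith
    finally show ?thesis .
  qed
  ultimately show ?thesis
    unfolding sq_summable_def by (rule summable_on_comparison_test) auto
qed

lemma sq_summable_prod:
  assumes "sq_summable f" "sq_summable g"
  shows "(\<lambda>i. cnj (f i) * g i) summable_on UNIV"
proof -
  have "(\<lambda>i. (cmod (f i))\<^sup>2 + (cmod (g i))\<^sup>2) summable_on UNIV"
    using assms unfolding sq_summable_def by (intro summable_on_add)
  moreover have "norm (cnj (f i) * g i) \<le> (cmod (f i))\<^sup>2 + (cmod (g i))\<^sup>2" for i
    using zero_le_power2[of "cmod (f i) - cmod (g i)"] mult_nonneg_nonneg[of "cmod (f i)" "cmod (g i)"]
    by (simp add: norm_mult power2_diff del: mult_nonneg_nonneg zero_le_mult_iff)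
  ultimately have "(\<lambda>i. norm (cnj (f i) * g i)) summable_on UNIV"
    by (rule summable_on_comparison_test) auto
  thus ?thesis by (rule abs_summable_summable)
qed

typedef 'i ell2 = "{f :: 'i \<Rightarrow> complex. sq_summable f}"
  morphisms coeff Abs_ell2
  using sq_summable_0 by blast

setup_lifting type_definition_ell2

lemma sq_summable_coeff: "sq_summable (coeff x)"
  using coeff by blast

lift_definition cscale :: "complex \<Rightarrow> 'i ell2 \<Rightarrow> 'i ell2" is "\<lambda>c f i. c * f i"
  by (rule sq_summable_mult)

definition cinner :: "'i ell2 \<Rightarrow> 'i ell2 \<Rightarrow> complex" where
  "cinner x y = (\<Sum>\<^sub>\<infinity>i. cnj (coeff x i) * coeff y i)"

instantiation ell2 :: (type) real_vector
begin

lift_definition zero_ell2 :: "'a ell2" is "\<lambda>_. 0" by (rule sq_summable_0)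
lift_definition plus_ell2 :: "'a ell2 \<Rightarrow> 'a ell2 \<Rightarrow> 'a ell2" is "\<lambda>f g i. f i + g i"
  by (rule sq_summable_add)
lift_definition uminus_ell2 :: "'a ell2 \<Rightarrow> 'a ell2" is "\<lambda>f i. - f i"
  by (simp add: sq_summable_def)
lift_definition minus_ell2 :: "'a ell2 \<Rightarrow> 'a ell2 \<Rightarrow> 'a ell2" is "\<lambda>f g i. f i - g i"
  using sq_summable_add sq_summable_mult[of _ "-1"] by fastforce
lift_definition scaleR_ell2 :: "real \<Rightarrow> 'a ell2 \<Rightarrow> 'a ell2" is "\<lambda>r f i. complex_of_real r * f i"
  by (rule sq_summable_mult)

instance
  by standard (transfer; auto simp: algebra_simps)+

end

instantiation ell2 :: (type) real_inner
begin

definition inner_ell2 :: "'a ell2 \<Rightarrow> 'a ell2 \<Rightarrow> real" where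
  "inner_ell2 x y = Re (cinner x y)"
definition norm_ell2 :: "'a ell2 \<Rightarrow> real" where
  "norm_ell2 x = sqrt (Re (cinner x x))"
definition sgn_ell2 :: "'a ell2 \<Rightarrow> 'a ell2" where
  "sgn_ell2 x = x /\<^sub>R norm x"
definition dist_ell2 :: "'a ell2 \<Rightarrow> 'a ell2 \<Rightarrow> real" where
  "dist_ell2 x y = norm (x - y)"
definition uniformity_ell2 :: "('a ell2 \<times> 'a ell2) filter" where
  "uniformity_ell2 = (INF e\<in>{0<..}. principal {(x, y). dist x y < e})"
definition open_ell2 :: "'a ell2 set \<Rightarrow> bool" where
  "open_ell2 U = (\<forall>x\<in>U. eventually (\<lambda>(x', y). x' = x \<longrightarrow> y \<in> U) uniformity)"

lemma Re_cinner: "Re (cinner x y) = (\<Sum>\<^sub>\<infinity>i. Re (cnj (coeff x i) * coeff y i))"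
  unfolding cinner_def
  using infsum_Re[OF sq_summable_prod[OF sq_summable_coeff[of x] sq_summable_coeff[of y]]] by simp

lemma Re_cinner_self: "Re (cinner x x) = (\<Sum>\<^sub>\<infinity>i. (cmod (coeff x i))\<^sup>2)"
  unfolding Re_cinner
  by (rule infsum_cong) (simp only: cmod_power2, simp add: power2_eq_square)

instance
proof
  fix x y z :: "'a ell2" and r :: real
  note S = sq_summable_prod[OF sq_summable_coeff sq_summable_coeff]
  show "inner x y = inner y x"
    unfolding inner_ell2_def Re_cinner by (rule infsum_cong) simp
  show "inner (x + y) z = inner x z + inner y z"
  proof -
    have "cinner (x + y) z = cinner x z + cinner y z"
      unfolding cinner_def plus_ell2.rep_eq
      by (simp add: distrib_right infsum_add[OF S S])
    thus ?thesis by (simp add: inner_ell2_def)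
  qed
  show "inner (r *\<^sub>R x) y = r * inner x y"
  proof -
    have "cinner (r *\<^sub>R x) y = complex_of_real r * cinner x y"
      unfolding cinner_def scaleR_ell2.rep_eq
      by (subst infsum_cmult_right[symmetric]) (auto intro: S simp: mult.assoc)
    thus ?thesis by (simp add: inner_ell2_def)
  qed
  show "0 \<le> inner x x"
    unfolding inner_ell2_def Re_cinner_self by (rule infsum_nonneg) simp
  show "inner x x = 0 \<longleftrightarrow> x = 0"
  proof
    assume "inner x x = 0"
    hence "(\<Sum>\<^sub>\<infinity>i. (cmod (coeff x i))\<^sup>2) \<le> 0" by (simp add: inner_ell2_def Re_cinner_self)
    hence "(cmod (coeff x i))\<^sup>2 = 0" for i
      by (rule nonneg_infsum_le_0D[where A = UNIV])
        (use sq_summable_coeff[of x] in \<open>auto simp: sq_summable_def\<close>)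
    thus "x = 0" by (simp add: coeff_inject[symmetric] zero_ell2.rep_eq fun_eq_iff)
  next
    assume "x = 0"
    thus "inner x x = 0" by (simp add: inner_ell2_def Re_cinner_self zero_ell2.rep_eq)
  qed
  show "norm x = sqrt (inner x x)" by (simp add: norm_ell2_def inner_ell2_def)
qed (simp_all add: sgn_ell2_def dist_ell2_def uniformity_ell2_def open_ell2_def)

end

lemma norm_ell2_eq: "norm x = sqrt (\<Sum>\<^sub>\<infinity>i. (cmod (coeff x i))\<^sup>2)"
  by (simp add: norm_ell2_def Re_cinner_self)

lemma bounded_linear_cscale: "bounded_linear (cscale c :: 'i ell2 \<Rightarrow> 'i ell2)"
proof (rule bounded_linear_intro[where K = "cmod c"])
  fix x y :: "'i ell2" and r :: real
  show "cscale c (x + y) = cscale c x + cscale c y"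
    by transfer (simp add: algebra_simps)
  show "cscale c (r *\<^sub>R x) = r *\<^sub>R cscale c x"
    by transfer (simp add: algebra_simps)
  show "norm (cscale c x) \<le> norm x * cmod c"
    using sq_summable_coeff[of x]
    by (simp add: norm_ell2_eq cscale.rep_eq norm_mult power_mult_distrib sq_summable_def
        infsum_cmult_right real_sqrt_mult)
qed

section \<open>Bounded operators\<close>

text \<open>The library's bounded linear maps are real-linear; the bounded operators of a complex Hilbert
  space are those among them that commute with complex scalars.\<close>

lift_definition cscaleL :: "complex \<Rightarrow> 'i ell2 \<Rightarrow>\<^sub>L 'i ell2" is cscale
  by (rule bounded_linear_cscale)

definition bounded_ops :: "('i ell2 \<Rightarrow>\<^sub>L 'i ell2) set" where
  "bounded_ops = {T. \<forall>c x. blinfun_apply T (cscale c x) = cscale c (blinfun_apply T x)}"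

definition op_adjoint :: "('i ell2 \<Rightarrow>\<^sub>L 'i ell2) \<Rightarrow> ('i ell2 \<Rightarrow>\<^sub>L 'i ell2)" where
  "op_adjoint T = (THE S. \<forall>x y. cinner (blinfun_apply S x) y = cinner x (blinfun_apply T y))"

definition weak_operator_topology :: "('i ell2 \<Rightarrow>\<^sub>L 'i ell2) topology" where
  "weak_operator_topology =
     pullback_topology UNIV (\<lambda>T (x, y). cinner x (blinfun_apply T y)) euclidean"

definition unital_op_algebra :: "('i ell2 \<Rightarrow>\<^sub>L 'i ell2) set \<Rightarrow> bool" where
  "unital_op_algebra A \<longleftrightarrow> A \<subseteq> bounded_ops \<and> id_blinfun \<in> A \<and>
     (\<forall>S\<in>A. \<forall>T\<in>A. S + T \<in> A \<and> S o\<^sub>L T \<in> A) \<and> (\<forall>c. \<forall>T\<in>A. cscaleL c o\<^sub>L T \<in> A)"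

definition cspan :: "'i ell2 set \<Rightarrow> 'i ell2 set" where
  "cspan S = {\<Sum>x\<in>F. cscale (c x) x | F c. finite F \<and> F \<subseteq> S}"

section \<open>The Fock space and its shifts\<close>

text \<open>A letter is an element of the finite type \<open>'d\<close> (so \<open>d = CARD('d)\<close>), a word is a list of
  letters, and a formal power series is its coefficient function.\<close>

type_synonym 'd fock = "'d list ell2"

lemma push_forward:
  assumes "inj g" and on: "\<And>\<alpha>. F (g \<alpha>) = f \<alpha>" and off: "\<And>\<gamma>. \<gamma> \<notin> range g \<Longrightarrow> F \<gamma> = 0"
  shows sq_summable_push: "sq_summable f \<Longrightarrow> sq_summable F"
    and infsum_push: "(\<Sum>\<^sub>\<infinity>\<gamma>. (cmod (F \<gamma>))\<^sup>2) = (\<Sum>\<^sub>\<infinity>\<alpha>. (cmod (f \<alpha>))\<^sup>2)"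
proof -
  have f: "(\<lambda>\<alpha>. (cmod (f \<alpha>))\<^sup>2) = (\<lambda>\<gamma>. (cmod (F \<gamma>))\<^sup>2) \<circ> g" by (auto simp: on)
  have *: "(\<lambda>\<gamma>. (cmod (F \<gamma>))\<^sup>2) summable_on UNIV \<longleftrightarrow> (\<lambda>\<gamma>. (cmod (F \<gamma>))\<^sup>2) summable_on range g"
    by (rule summable_on_cong_neutral) (auto simp: off)
  show "sq_summable F" if "sq_summable f"
    using that unfolding sq_summable_def * f using summable_on_reindex[OF \<open>inj g\<close>] by blast
  have "(\<Sum>\<^sub>\<infinity>\<gamma>. (cmod (F \<gamma>))\<^sup>2) = (\<Sum>\<^sub>\<infinity>\<gamma>\<in>range g. (cmod (F \<gamma>))\<^sup>2)"
    by (rule infsum_cong_neutral) (auto simp: off)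
  also have "\<dots> = (\<Sum>\<^sub>\<infinity>\<alpha>. (cmod (f \<alpha>))\<^sup>2)"
    unfolding f by (rule infsum_reindex[OF \<open>inj g\<close>])
  finally show "(\<Sum>\<^sub>\<infinity>\<gamma>. (cmod (F \<gamma>))\<^sup>2) = (\<Sum>\<^sub>\<infinity>\<alpha>. (cmod (f \<alpha>))\<^sup>2)" .
qed

lemma inj_snoc: "inj (\<lambda>\<alpha>. \<alpha> @ [k])"
  by (auto simp: inj_on_def)

lift_definition Lfun :: "'d \<Rightarrow> 'd fock \<Rightarrow> 'd fock" is
  "\<lambda>k f \<gamma>. if \<gamma> \<noteq> [] \<and> hd \<gamma> = k then f (tl \<gamma>) else 0"
  subgoal for k f
    by (rule sq_summable_push[of "(#) k"]) (auto simp: image_iff neq_Nil_conv)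
  done

lift_definition Rfun :: "'d \<Rightarrow> 'd fock \<Rightarrow> 'd fock" is
  "\<lambda>k f \<gamma>. if \<gamma> \<noteq> [] \<and> last \<gamma> = k then f (butlast \<gamma>) else 0"
  subgoal for k f
    by (rule sq_summable_push[OF inj_snoc[of k]])
      (auto simp: image_iff, metis append_butlast_last_id)
  done

lemma norm_Lfun: "norm (Lfun k f) = norm f"
  unfolding norm_ell2_eq Lfun.rep_eq
  by (subst infsum_push[of "(#) k"]) (auto simp: image_iff neq_Nil_conv)

lemma norm_Rfun: "norm (Rfun k f) = norm f"
  unfolding norm_ell2_eq Rfun.rep_eq
  by (subst infsum_push[OF inj_snoc[of k]])
    (auto simp: image_iff, metis append_butlast_last_id)

lift_definition Lshift :: "'d \<Rightarrow> 'd fock \<Rightarrow>\<^sub>L 'd fock" is Lfun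
  by (rule bounded_linear_intro[where K = 1]; (simp only: norm_Lfun mult_1_right order_refl)?;
      transfer; auto)

lift_definition Rshift :: "'d \<Rightarrow> 'd fock \<Rightarrow>\<^sub>L 'd fock" is Rfun
  by (rule bounded_linear_intro[where K = 1]; (simp only: norm_Rfun mult_1_right order_refl)?;
      transfer; auto)

primrec Rword :: "'d list \<Rightarrow> 'd fock \<Rightarrow>\<^sub>L 'd fock" where
  "Rword [] = id_blinfun"
| "Rword (k # \<alpha>) = Rshift k o\<^sub>L Rword \<alpha>"

lift_definition vacuum :: "'d fock" is "\<lambda>\<alpha>. if \<alpha> = [] then 1 else 0"
  unfolding sq_summable_def
  by (subst summable_on_cong_neutral[where S = UNIV and T = "{[]}" and g = "\<lambda>_. 1"]) auto

definition nc_polynomial :: "'d fock \<Rightarrow> bool" where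
  "nc_polynomial f \<longleftrightarrow> finite {\<alpha>. coeff f \<alpha> \<noteq> 0}"

text \<open>Meaningful for nonzero polynomials only.\<close>
definition nc_degree :: "'d fock \<Rightarrow> nat" where
  "nc_degree f = Max (length ` {\<alpha>. coeff f \<alpha> \<noteq> 0})"

definition Hinf_algebra :: "('d fock \<Rightarrow>\<^sub>L 'd fock) set" where
  "Hinf_algebra =
     (\<lambda>A. unital_op_algebra A \<and> closedin weak_operator_topology A) hull range Lshift"

definition Hinf :: "'d fock set" where
  "Hinf = (\<lambda>T. blinfun_apply T vacuum) ` Hinf_algebra"

text \<open>The operator \<open>F(L)\<close> belonging to the series \<open>F = F(L)1\<close>.\<close>
definition op_of :: "'d fock \<Rightarrow> 'd fock \<Rightarrow>\<^sub>L 'd fock" where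
  "op_of F = (THE T. T \<in> Hinf_algebra \<and> blinfun_apply T vacuum = F)"

definition nc_inner :: "'d fock \<Rightarrow> bool" where
  "nc_inner \<Theta> \<longleftrightarrow> \<Theta> \<in> Hinf \<and> (\<forall>h. norm (op_of \<Theta> h) = norm h)"

definition nc_outer :: "'d fock \<Rightarrow> bool" where
  "nc_outer f \<longleftrightarrow> closure (cspan (range (\<lambda>\<alpha>. Rword \<alpha> f))) = UNIV"

section \<open>Evaluation in the row ball\<close>

definition vec_norm2 :: "complex vec \<Rightarrow> real" where
  "vec_norm2 v = sqrt (Re (v \<bullet>c v))"

definition mat_norm :: "nat \<Rightarrow> complex mat \<Rightarrow> real" where
  "mat_norm n A = (SUP v\<in>{v \<in> carrier_vec n. vec_norm2 v \<le> 1}. vec_norm2 (A *\<^sub>v v))"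

definition mat_tuples :: "nat \<Rightarrow> ('d \<Rightarrow> complex mat) set" where
  "mat_tuples n = {X. \<forall>k. X k \<in> carrier_mat n n}"

definition row_gram :: "nat \<Rightarrow> ('d::finite \<Rightarrow> complex mat) \<Rightarrow> complex mat" where
  "row_gram n X = Matrix.mat n n (\<lambda>ab. \<Sum>j\<in>UNIV. (X j * mat_adjoint (X j)) $$ ab)"

definition row_ball :: "nat \<Rightarrow> ('d::finite \<Rightarrow> complex mat) set" where
  "row_ball n = {X \<in> mat_tuples n. mat_norm n (row_gram n X) < 1}"

primrec mat_word :: "nat \<Rightarrow> ('d \<Rightarrow> complex mat) \<Rightarrow> 'd list \<Rightarrow> complex mat" where
  "mat_word n X [] = 1\<^sub>m n"
| "mat_word n X (k # \<alpha>) = X k * mat_word n X \<alpha>"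

definition mat_term ::
    "nat \<Rightarrow> ('d::finite list \<Rightarrow> complex) \<Rightarrow> ('d \<Rightarrow> complex mat) \<Rightarrow> nat \<Rightarrow> nat \<times> nat \<Rightarrow> complex" where
  "mat_term n c X k ab = (\<Sum>\<alpha>\<in>{\<alpha>. length \<alpha> = k}. c \<alpha> * mat_word n X \<alpha> $$ ab)"

definition mat_eval ::
    "nat \<Rightarrow> ('d::finite list \<Rightarrow> complex) \<Rightarrow> ('d \<Rightarrow> complex mat) \<Rightarrow> complex mat" where
  "mat_eval n c X = Matrix.mat n n (\<lambda>ab. \<Sum>k. mat_term n c X k ab)"

text \<open>The infinite level; the separable Hilbert space is \<open>nat ell2\<close>, and the series converges in
  operator norm.\<close>

definition row_ball_inf :: "('d::finite \<Rightarrow> (nat ell2 \<Rightarrow>\<^sub>L nat ell2)) set" where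
  "row_ball_inf = {X. range X \<subseteq> bounded_ops \<and> norm (\<Sum>j\<in>UNIV. X j o\<^sub>L op_adjoint (X j)) < 1}"

primrec op_word :: "('d \<Rightarrow> (nat ell2 \<Rightarrow>\<^sub>L nat ell2)) \<Rightarrow> 'd list \<Rightarrow> (nat ell2 \<Rightarrow>\<^sub>L nat ell2)" where
  "op_word X [] = id_blinfun"
| "op_word X (k # \<alpha>) = X k o\<^sub>L op_word X \<alpha>"

definition op_eval ::
    "('d::finite list \<Rightarrow> complex) \<Rightarrow> ('d \<Rightarrow> (nat ell2 \<Rightarrow>\<^sub>L nat ell2)) \<Rightarrow> (nat ell2 \<Rightarrow>\<^sub>L nat ell2)" where
  "op_eval c X = (\<Sum>k. \<Sum>\<alpha>\<in>{\<alpha>. length \<alpha> = k}. cscaleL (c \<alpha>) o\<^sub>L op_word X \<alpha>)"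

text \<open>The scalar \<open>y\<^sup>* A v\<close>; the inner product of the matrix library is conjugate-linear in the
  second argument.\<close>
definition mat_form :: "complex vec \<Rightarrow> complex mat \<Rightarrow> complex vec \<Rightarrow> complex" where
  "mat_form y A v = (A *\<^sub>v v) \<bullet>c y"

definition szego_kernel ::
    "nat \<Rightarrow> ('d::finite \<Rightarrow> complex mat) \<Rightarrow> complex vec \<Rightarrow> complex vec \<Rightarrow> 'd fock" where
  "szego_kernel n Z y v = (THE k. \<forall>f. cinner k f = mat_form y (mat_eval n (coeff f) Z) v)"

section \<open>Singularity loci and NC Blaschke inner functions\<close>

text \<open>A row vector \<open>y\<^sup>* A\<close> is treated as the functional \<open>v \<mapsto> y\<^sup>* A v\<close>.\<close>

definition mat_annihilates :: "nat \<Rightarrow> 'd::finite fock \<Rightarrow> ('d \<Rightarrow> complex mat) \<Rightarrow> complex vec \<Rightarrow> bool" where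
  "mat_annihilates n f Z y \<longleftrightarrow> (\<forall>v\<in>carrier_vec n. mat_form y (mat_eval n (coeff f) Z) v = 0)"

definition op_annihilates :: "'d::finite fock \<Rightarrow> ('d \<Rightarrow> (nat ell2 \<Rightarrow>\<^sub>L nat ell2)) \<Rightarrow> nat ell2 \<Rightarrow> bool" where
  "op_annihilates f Z y \<longleftrightarrow> (\<forall>v. cinner y (op_eval (coeff f) Z v) = 0)"

definition Sing :: "nat \<Rightarrow> 'd::finite fock \<Rightarrow> (('d \<Rightarrow> complex mat) \<times> complex vec) set" where
  "Sing n f = {(Z, y). Z \<in> row_ball n \<and> y \<in> carrier_vec n \<and> y \<noteq> 0\<^sub>v n \<and> mat_annihilates n f Z y}"

definition Sing_inf :: "'d::finite fock \<Rightarrow> (('d \<Rightarrow> (nat ell2 \<Rightarrow>\<^sub>L nat ell2)) \<times> nat ell2) set" where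
  "Sing_inf f = {(Z, y). Z \<in> row_ball_inf \<and> y \<noteq> 0 \<and> op_annihilates f Z y}"

definition nc_blaschke :: "'d::finite fock \<Rightarrow> bool" where
  "nc_blaschke \<Theta> \<longleftrightarrow> nc_inner \<Theta> \<and>
     range (blinfun_apply (op_of \<Theta>)) =
       {h. (\<forall>n\<ge>1. \<forall>(Z, y)\<in>Sing n \<Theta>. mat_annihilates n h Z y) \<and>
           (\<forall>(Z, y)\<in>Sing_inf \<Theta>. op_annihilates h Z y)}"

section \<open>NC rational functions\<close>

datatype 'd nc_expr =
    Var 'd
  | Scalar complex
  | Add "'d nc_expr" "'d nc_expr"
  | Mul "'d nc_expr" "'d nc_expr"
  | Inv "'d nc_expr"

text \<open>The value is \<open>None\<close> as soon as some subexpression to be inverted is singular.\<close>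
primrec expr_eval :: "nat \<Rightarrow> ('d \<Rightarrow> complex mat) \<Rightarrow> 'd nc_expr \<Rightarrow> complex mat option" where
  "expr_eval n X (Var k) = Some (X k)"
| "expr_eval n X (Scalar c) = Some (c \<cdot>\<^sub>m 1\<^sub>m n)"
| "expr_eval n X (Add r s) =
     Option.bind (expr_eval n X r) (\<lambda>A. map_option (\<lambda>B. A + B) (expr_eval n X s))"
| "expr_eval n X (Mul r s) =
     Option.bind (expr_eval n X r) (\<lambda>A. map_option (\<lambda>B. A * B) (expr_eval n X s))"
| "expr_eval n X (Inv r) = Option.bind (expr_eval n X r) mat_inverse"

text \<open>The size \<open>0\<close> must be excluded: there every expression could be evaluated.\<close>
definition expr_dom :: "'d nc_expr \<Rightarrow> (nat \<times> ('d \<Rightarrow> complex mat)) set" where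
  "expr_dom r = {(n, X). n \<ge> 1 \<and> X \<in> mat_tuples n \<and> expr_eval n X r \<noteq> None}"

definition valid_exprs :: "'d nc_expr set" where
  "valid_exprs = {r. expr_dom r \<noteq> {}}"

definition expr_equiv :: "('d nc_expr \<times> 'd nc_expr) set" where
  "expr_equiv = {(r, s). r \<in> valid_exprs \<and> s \<in> valid_exprs \<and> expr_dom r \<inter> expr_dom s \<noteq> {} \<and>
     (\<forall>(n, X)\<in>expr_dom r \<inter> expr_dom s. expr_eval n X r = expr_eval n X s)}"

definition nc_rational_functions :: "'d nc_expr set set" where
  "nc_rational_functions = valid_exprs // expr_equiv"

text \<open>\<open>c\<close> is the power series at \<open>0\<close> of the rational function \<open>\<rr>\<close>, which is then
  regular at \<open>0\<close>: some representative can be evaluated on a row ball of positive radius around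
  \<open>0\<close>, uniformly in the matrix size, and equals the sum of the series there.\<close>
definition power_series_at_0 :: "'d::finite nc_expr set \<Rightarrow> ('d list \<Rightarrow> complex) \<Rightarrow> bool" where
  "power_series_at_0 \<rr> c \<longleftrightarrow> (\<exists>r\<in>\<rr>. \<exists>\<rho>>0. \<forall>n\<ge>1. \<forall>X\<in>mat_tuples n.
     mat_norm n (row_gram n X) < \<rho> \<longrightarrow>
       (\<forall>a<n. \<forall>b<n. summable (\<lambda>k. mat_term n c X k (a, b))) \<and>
       expr_eval n X r = Some (mat_eval n c X))"

definition nc_rational :: "'d::finite fock \<Rightarrow> bool" where
  "nc_rational f \<longleftrightarrow> (\<exists>\<rr>\<in>nc_rational_functions. power_series_at_0 \<rr> (coeff f))"

end

theory Submission
  imports Defs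
begin

text \<open>
  Let \<open>T = \<Theta>(L)\<close>, an isometry that commutes with the right shifts, so that \<open>T z\<^sup>\<beta> = \<Theta> z\<^sup>\<beta>\<close>. The coefficient of
  \<open>f\<close> at \<open>\<beta>\<close> is \<open>\<langle>z\<^sup>\<beta>, f\<rangle> = \<langle>\<Theta> z\<^sup>\<beta>, p\<rangle>\<close> and vanishes when \<open>\<beta>\<close> is longer than the degree of \<open>p\<close>; this bounds the
  degree of the outer factor (\<open>quotient_degree\<close>). Point evaluations are continuous on the Fock space, so
  at a point \<open>X\<close> of the row ball a row vector that annihilates \<open>f(X)\<close>, and with it all \<open>f(X) X\<^sup>\<beta>\<close>, annihilates
  every value \<open>g(X)\<close>, since \<open>f\<close> is outer. So \<open>f(X)\<close> is invertible (\<open>outer_invertible\<close>), and \<open>p(X) = \<Theta>(X) f(X)\<close>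
  exhibits \<open>\<Theta>\<close> as the rational function \<open>p f\<^sup>-\<^sup>1\<close>.

  The range of \<open>T\<close> satisfies the constraints imposed by the singular points of \<open>\<Theta>\<close>, again by continuity
  of evaluation. The converse is the heart of the matter. The vectors \<open>u = x - T T\<^sup>* x\<close>, with \<open>x\<close> a polynomial,
  are dense in the orthogonal complement of the range (\<open>mem_rangeI\<close>), and each of them has to be detected by
  a singular point. On the boundary of the ball there is an obvious candidate: the tuple \<open>L\<close> with the
  vector \<open>u\<close>, because \<open>\<langle>u, \<Theta>(L) z\<^sup>\<beta>\<rangle> = \<langle>u, T z\<^sup>\<beta>\<rangle> = 0\<close>. It can be moved inside: if the weights \<open>r\<^sup>n\<close> on words of
  length \<open>n\<close>, for some \<open>r > 1\<close>, keep \<open>u\<close> square-summable, then the strict row contraction \<open>r\<^sup>-\<^sup>1L\<close> together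
  with the weighted vector does the same job (\<open>decaying_vector_point\<close>).

  What remains is the decay of \<open>u\<close>. As \<open>T\<^sup>* x\<close> is a polynomial, for the same reason as \<open>f\<close> is one, it
  reduces to the decay of \<open>\<Theta>\<close>. Now \<open>\<Theta> f = p\<close>, so the product rule for backward left shifts shows that all
  iterated backward shifts \<open>g\<close> of \<open>\<Theta>\<close> have products \<open>g f\<close> that are polynomials of bounded degree, and \<open>f\<close> is
  not a zero divisor. Hence they span a finite-dimensional invariant space. The tails of its elements tend
  to zero uniformly on the unit ball, so a fixed number of shifts halves them, and iterating this gives
  geometric decay (\<open>rational_decays\<close>).
\<close>

section \<open>Hilbert space geometry of square-summable families\<close>

lemma abs_eq_cmod: "complex_of_real x = z \<Longrightarrow> \<bar>x\<bar> = cmod z"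
  by auto

lemma infsum_finite_sum:
  fixes f :: "'a \<Rightarrow> 'b \<Rightarrow> complex"
  assumes "\<And>a. a \<in> A \<Longrightarrow> f a summable_on S"
  shows "(\<Sum>\<^sub>\<infinity>x\<in>S. \<Sum>a\<in>A. f a x) = (\<Sum>a\<in>A. infsum (f a) S)"
proof -
  have "(\<lambda>x. \<Sum>a\<in>A. f a x) summable_on S \<and>
      (\<Sum>\<^sub>\<infinity>x\<in>S. \<Sum>a\<in>A. f a x) = (\<Sum>a\<in>A. infsum (f a) S)"
    using assms by (induction A rule: infinite_finite_induct) (auto simp: infsum_add summable_on_add)
  thus ?thesis ..
qed

lemma ell2_eqI: "(\<And>i. coeff x i = coeff y i) \<Longrightarrow> x = y"
  by (simp add: coeff_inject[symmetric] fun_eq_iff)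

lemma coeff_zero [simp]: "coeff 0 i = 0"
  by (simp add: zero_ell2.rep_eq)

lemma coeff_plus [simp]: "coeff (x + y) i = coeff x i + coeff y i"
  by (simp add: plus_ell2.rep_eq)

lemma coeff_minus [simp]: "coeff (x - y) i = coeff x i - coeff y i"
  by (simp add: minus_ell2.rep_eq)

lemma coeff_scaleR [simp]: "coeff (r *\<^sub>R x) i = of_real r * coeff x i"
  by (simp add: scaleR_ell2.rep_eq)

lemma coeff_cscale [simp]: "coeff (cscale c x) i = c * coeff x i"
  by (simp add: cscale.rep_eq)

lemma coeff_sum [simp]: "coeff (\<Sum>a\<in>A. x a) i = (\<Sum>a\<in>A. coeff (x a) i)"
  by (induction A rule: infinite_finite_induct) auto

lemma cscale_simps [simp]:
  "cscale 1 x = x" "cscale 0 x = 0" "cscale c 0 = 0" "cscale a (cscale b x) = cscale (a * b) x"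
  by (auto intro!: ell2_eqI)

lemma cscale_add: "cscale c (x + y) = cscale c x + cscale c y"
  by (auto intro!: ell2_eqI simp: algebra_simps)

lemma cscale_of_real: "cscale (of_real r) x = r *\<^sub>R x"
  by (auto intro!: ell2_eqI)

lemma cscale_scaleR: "cscale c (r *\<^sub>R x) = r *\<^sub>R cscale c x"
  by (auto intro!: ell2_eqI)

lemma norm_sq_coeff: "(norm x)\<^sup>2 = (\<Sum>\<^sub>\<infinity>i. (cmod (coeff x i))\<^sup>2)"
  by (simp add: norm_ell2_eq infsum_nonneg)

lemma summable_coeff: "(\<lambda>i. (cmod (coeff x i))\<^sup>2) summable_on UNIV"
  using sq_summable_coeff[of x] by (simp add: sq_summable_def)

lemma norm_cscale: "norm (cscale c x) = cmod c * norm x"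
proof -
  have "(norm (cscale c x))\<^sup>2 = (cmod c * norm x)\<^sup>2"
    by (simp add: norm_sq_coeff power_mult_distrib norm_mult infsum_cmult_right summable_coeff)
  thus ?thesis by simp
qed

lemma sum_coeff_le_norm: "finite F \<Longrightarrow> (\<Sum>i\<in>F. (cmod (coeff x i))\<^sup>2) \<le> (norm x)\<^sup>2"
  unfolding norm_sq_coeff by (rule finite_sum_le_infsum[OF summable_coeff]) auto

lemma sq_summable_bounded:
  assumes "\<And>F. finite F \<Longrightarrow> (\<Sum>i\<in>F. (cmod (f i))\<^sup>2) \<le> B"
  shows "sq_summable f"
  unfolding sq_summable_def
  by (rule nonneg_bdd_above_summable_on) (use assms in \<open>auto intro!: bdd_aboveI2\<close>)

lemma norm_sq_le:
  assumes "\<And>F. finite F \<Longrightarrow> (\<Sum>i\<in>F. (cmod (coeff x i))\<^sup>2) \<le> B"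
  shows "(norm x)\<^sup>2 \<le> B"
  unfolding norm_sq_coeff by (rule infsum_le_finite_sums[OF summable_coeff]) (use assms in auto)

lemma coeff_Abs: "sq_summable f \<Longrightarrow> coeff (Abs_ell2 f) i = f i"
  by (simp add: Abs_ell2_inverse)

lemma norm_le_norm:
  assumes "\<And>i. cmod (coeff x i) \<le> cmod (coeff y i)"
  shows "norm x \<le> norm y"
proof -
  have "(norm x)\<^sup>2 \<le> (norm y)\<^sup>2"
    unfolding norm_sq_coeff
    by (intro infsum_mono summable_coeff power_mono assms) auto
  thus ?thesis by simp
qed

lemma summable_cinner: "(\<lambda>i. cnj (coeff x i) * coeff y i) summable_on UNIV"
  by (rule sq_summable_prod[OF sq_summable_coeff sq_summable_coeff])

lemma cinner_add_right: "cinner x (y + z) = cinner x y + cinner x z"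
  unfolding cinner_def by (simp add: distrib_left infsum_add summable_cinner)

lemma cinner_cscale_right: "cinner x (cscale c y) = c * cinner x y"
  unfolding cinner_def
  by (simp add: mult.left_commute[of _ c] infsum_cmult_right')

lemma cinner_commute: "cinner x y = cnj (cinner y x)"
  unfolding cinner_def infsum_cnj[symmetric] by (rule infsum_cong) (simp add: mult.commute)

lemma cinner_scaleR_right: "cinner x (r *\<^sub>R y) = of_real r * cinner x y"
  by (simp flip: cscale_of_real add: cinner_cscale_right)

lemma cinner_zero_right [simp]: "cinner x 0 = 0"
  by (simp add: cinner_def)

lemma cinner_minus_right: "cinner x (y - z) = cinner x y - cinner x z"
  using cinner_add_right[of x "y - z" z] by simp

lemma cinner_sum_right: "cinner x (\<Sum>a\<in>A. f a) = (\<Sum>a\<in>A. cinner x (f a))"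
  by (induction A rule: infinite_finite_induct) (auto simp: cinner_add_right)

lemma cinner_minus_left: "cinner (x - y) z = cinner x z - cinner y z"
  by (subst (1 2 3) cinner_commute) (simp add: cinner_minus_right)

lemma cinner_cscale_left: "cinner (cscale c x) y = cnj c * cinner x y"
  by (subst (1 2) cinner_commute) (simp add: cinner_cscale_right)

lemma cinner_zero_left [simp]: "cinner 0 x = 0"
  by (simp add: cinner_def)

lemma cinner_self: "cinner x x = of_real ((norm x)\<^sup>2)"
proof (rule complex_eqI)
  show "Re (cinner x x) = Re (of_real ((norm x)\<^sup>2))"
    using power2_norm_eq_inner[of x] by (simp add: inner_ell2_def)
  have "cnj (cinner x x) = cinner x x" by (rule cinner_commute[symmetric])
  hence "Im (cnj (cinner x x)) = Im (cinner x x)" by (rule arg_cong)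
  thus "Im (cinner x x) = Im (of_real ((norm x)\<^sup>2))" by simp
qed

lemma cinner_via_inner: "cinner x y = Complex (inner x y) (inner x (cscale (- \<i>) y))"
  by (rule complex_eqI) (simp_all add: inner_ell2_def cinner_cscale_right)

lemma cinner_bound: "cmod (cinner x y) \<le> norm x * norm y"
proof -
  \<comment> \<open>A unimodular factor makes the inner product real, where the real Cauchy-Schwarz inequality applies.\<close>
  define c where "c = cnj (sgn (cinner x y))"
  have c: "cmod c \<le> 1" by (auto simp: c_def norm_sgn)
  have "of_real (cmod (cinner x y)) = c * cinner x y"
  proof (cases "cinner x y = 0")
    case False
    have "cinner x y * cnj (cinner x y) = of_real ((cmod (cinner x y))\<^sup>2)"
      by (simp only: complex_norm_square)
    thus ?thesis using False
      by (simp add: c_def sgn_eq power2_eq_square field_simps)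
  qed (simp add: c_def)
  hence "cmod (cinner x y) = Re (cinner x (cscale c y))"
    by (metis Re_complex_of_real cinner_cscale_right)
  also have "\<dots> = inner x (cscale c y)" by (simp add: inner_ell2_def)
  also have "\<dots> \<le> norm x * norm (cscale c y)" by (rule norm_cauchy_schwarz)
  also have "\<dots> \<le> norm x * norm y"
    unfolding norm_cscale using c by (intro mult_left_mono mult_left_le_one_le) auto
  finally show ?thesis .
qed

lemma bounded_linear_cinner: "bounded_linear (cinner x)"
  by (rule bounded_linear_intro[where K = "norm x"])
    (auto simp: cinner_add_right cinner_scaleR_right scaleR_conv_of_real mult.commute
       intro: order_trans[OF cinner_bound])

lemmas tendsto_cinner_right = bounded_linear.tendsto[OF bounded_linear_cinner]

lemma tendsto_cinner_left: "(f \<longlongrightarrow> a) F \<Longrightarrow> ((\<lambda>t. cinner (f t) x) \<longlongrightarrow> cinner a x) F"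
  by (subst (1 2) cinner_commute) (intro tendsto_cnj tendsto_cinner_right)

lemma cinner_eqI:
  assumes "\<And>y. cinner y x = cinner y x'"
  shows "x = x'"
  using assms[of "x - x'"] cinner_self[of "x - x'"] by (simp add: cinner_minus_right)

lemma cinner_eq_iff: "(\<forall>y. cinner y x = cinner y x') \<longleftrightarrow> x = x'"
  using cinner_eqI by blast

text \<open>Polarization gives the real part of the inner product; the imaginary part is the real part for the
  second vector multiplied by \<open>-\<i>\<close>, and here complex linearity enters.\<close>

lemma cinner_isometry:
  assumes "bounded_linear T" and "\<And>c x. T (cscale c x) = cscale c (T x)"
    and norm: "\<And>x. norm (T x) = norm x"
  shows "cinner (T x) (T y) = cinner x y"
proof -
  interpret bounded_linear T by fact
  have "inner (T x) (T y) = inner x y" for x y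
    using norm[of "x + y"] norm[of x] norm[of y]
    by (simp add: add norm_eq_sqrt_inner inner_add inner_commute)
  thus ?thesis by (simp add: cinner_via_inner assms(2)[symmetric])
qed

text \<open>Completeness is what makes operator series converge and what produces preimages under an
  isometry. The limit of a Cauchy sequence is the coordinatewise limit: a bound on all finite partial
  sums of the squared distance survives the coordinatewise limit.\<close>

instance ell2 :: (type) banach
proof
  fix X :: "nat \<Rightarrow> 'a ell2" assume X: "Cauchy X"
  have close: "cmod (coeff x i) \<le> norm x" for x :: "'a ell2" and i
    using sum_coeff_le_norm[of "{i}" x] by simp
  have "Cauchy (\<lambda>m. coeff (X m) i)" for i
  proof (rule CauchyI)
    fix e :: real assume "e > 0"
    then obtain M where M: "\<And>m n. m \<ge> M \<Longrightarrow> n \<ge> M \<Longrightarrow> norm (X m - X n) < e"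
      using CauchyD[OF X] by blast
    have "cmod (coeff (X m) i - coeff (X n) i) < e" if "m \<ge> M" "n \<ge> M" for m n
      using close[of "X m - X n" i] M[OF that] by simp
    thus "\<exists>M. \<forall>m\<ge>M. \<forall>n\<ge>M. norm (coeff (X m) i - coeff (X n) i) < e" by blast
  qed
  then obtain c where c: "\<And>i. (\<lambda>m. coeff (X m) i) \<longlonglongrightarrow> c i"
    unfolding Cauchy_convergent_iff convergent_def by metis
  have bound: "\<exists>M. \<forall>n\<ge>M. \<forall>F. finite F \<longrightarrow> (\<Sum>i\<in>F. (cmod (c i - coeff (X n) i))\<^sup>2) \<le> e\<^sup>2"
    if "e > 0" for e
  proof -
    obtain M where M: "\<And>m n. m \<ge> M \<Longrightarrow> n \<ge> M \<Longrightarrow> norm (X m - X n) < e"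
      using CauchyD[OF X \<open>e > 0\<close>] by blast
    have "(\<Sum>i\<in>F. (cmod (c i - coeff (X n) i))\<^sup>2) \<le> e\<^sup>2" if "n \<ge> M" "finite F" for n F
    proof (rule tendsto_upperbound)
      show "(\<lambda>m. \<Sum>i\<in>F. (cmod (coeff (X m) i - coeff (X n) i))\<^sup>2)
              \<longlonglongrightarrow> (\<Sum>i\<in>F. (cmod (c i - coeff (X n) i))\<^sup>2)"
        by (intro tendsto_intros c)
      have "(\<Sum>i\<in>F. (cmod (coeff (X m) i - coeff (X n) i))\<^sup>2) \<le> e\<^sup>2" if "m \<ge> M" for m
      proof -
        have "(\<Sum>i\<in>F. (cmod (coeff (X m) i - coeff (X n) i))\<^sup>2) \<le> (norm (X m - X n))\<^sup>2"
          using sum_coeff_le_norm[OF \<open>finite F\<close>, of "X m - X n"] by simp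
        also have "\<dots> \<le> e\<^sup>2"
          using M[OF that \<open>n \<ge> M\<close>] by (intro power_mono) auto
        finally show ?thesis .
      qed
      thus "\<forall>\<^sub>F m in sequentially. (\<Sum>i\<in>F. (cmod (coeff (X m) i - coeff (X n) i))\<^sup>2) \<le> e\<^sup>2"
        unfolding eventually_sequentially by blast
    qed simp
    thus ?thesis by blast
  qed
  obtain M where "\<forall>F. finite F \<longrightarrow> (\<Sum>i\<in>F. (cmod (c i - coeff (X M) i))\<^sup>2) \<le> 1\<^sup>2"
    using bound[of 1] by auto
  hence "sq_summable (\<lambda>i. c i - coeff (X M) i)"
    by (intro sq_summable_bounded[where B = "1\<^sup>2"]) auto
  from sq_summable_add[OF this sq_summable_coeff[of "X M"]]
  have c': "sq_summable c" by simp
  have "X \<longlonglongrightarrow> Abs_ell2 c"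
  proof (rule LIMSEQ_I)
    fix e :: real assume "e > 0"
    then obtain M where
      M: "\<And>n F. n \<ge> M \<Longrightarrow> finite F \<Longrightarrow> (\<Sum>i\<in>F. (cmod (c i - coeff (X n) i))\<^sup>2) \<le> (e/2)\<^sup>2"
      using bound[of "e/2"] by auto
    have "norm (X n - Abs_ell2 c) < e" if "n \<ge> M" for n
    proof -
      have "(norm (X n - Abs_ell2 c))\<^sup>2 \<le> (e/2)\<^sup>2"
        by (rule norm_sq_le) (use M[OF that] in \<open>simp add: coeff_Abs[OF c'] norm_minus_commute\<close>)
      hence "norm (X n - Abs_ell2 c) \<le> e/2" using \<open>e > 0\<close> by (simp add: power2_le_iff_abs_le)
      thus ?thesis using \<open>e > 0\<close> by simp
    qed
    thus "\<exists>M. \<forall>n\<ge>M. norm (X n - Abs_ell2 c) < e" by blast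
  qed
  thus "convergent X" by (auto simp: convergent_def)
qed

lift_definition unit :: "'i \<Rightarrow> 'i ell2" is "\<lambda>i j. if j = i then 1 else 0"
proof (rule sq_summable_bounded)
  fix i :: 'i and F :: "'i set" assume "finite F"
  have "(\<Sum>j\<in>F. (cmod (if j = i then 1 else 0))\<^sup>2) = (\<Sum>j\<in>F. if j = i then 1 else 0)"
    by (rule sum.cong) auto
  also have "\<dots> \<le> 1" using \<open>finite F\<close> by simp
  finally show "(\<Sum>j\<in>F. (cmod (if j = i then 1 else 0))\<^sup>2) \<le> 1" .
qed

lift_definition restr :: "'i set \<Rightarrow> 'i ell2 \<Rightarrow> 'i ell2" is "\<lambda>S f i. if i \<in> S then f i else 0"
proof -
  fix S and f :: "'i \<Rightarrow> complex" assume f: "sq_summable f"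
  show "sq_summable (\<lambda>i. if i \<in> S then f i else 0)"
    unfolding sq_summable_def
    by (rule summable_on_comparison_test[OF f[unfolded sq_summable_def]]) auto
qed

lemma coeff_unit: "coeff (unit i) j = (if j = i then 1 else 0)"
  by (simp add: unit.rep_eq)

lemma coeff_restr: "coeff (restr S x) i = (if i \<in> S then coeff x i else 0)"
  by (simp add: restr.rep_eq)

lemma cinner_unit_left: "cinner (unit i) x = coeff x i"
proof -
  have "cinner (unit i) x = (\<Sum>\<^sub>\<infinity>j\<in>{i}. coeff x j)"
    unfolding cinner_def by (rule infsum_cong_neutral) (auto simp: coeff_unit)
  thus ?thesis by simp
qed

lemma cinner_unit_right: "cinner x (unit i) = cnj (coeff x i)"
  by (subst cinner_commute) (simp add: cinner_unit_left)

lemma restr_finite: "finite F \<Longrightarrow> restr F x = (\<Sum>i\<in>F. cscale (coeff x i) (unit i))"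
  by (rule ell2_eqI) (simp add: coeff_restr coeff_unit if_distrib sum.delta' cong: if_cong)

lemma linear_restr: "linear (restr S)"
  by (rule linearI) (auto intro!: ell2_eqI simp: coeff_restr)

lemma norm_sq_restr: "(norm (restr S x))\<^sup>2 = (\<Sum>\<^sub>\<infinity>i\<in>S. (cmod (coeff x i))\<^sup>2)"
  unfolding norm_sq_coeff by (rule infsum_cong_neutral) (auto simp: coeff_restr)

lemma norm_restr_mono: "S \<subseteq> S' \<Longrightarrow> norm (restr S x) \<le> norm (restr S' x)"
  by (rule norm_le_norm) (auto simp: coeff_restr)

lemma finite_approximation:
  assumes "e > 0"
  obtains F where "finite F" "norm (restr (- F) x) < e"
proof -
  let ?a = "\<lambda>i. (cmod (coeff x i))\<^sup>2"
  have "(sum ?a \<longlongrightarrow> infsum ?a UNIV) (finite_subsets_at_top UNIV)"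
    using summable_coeff[of x] by (rule infsum_tendsto)
  hence "\<forall>\<^sub>F F in finite_subsets_at_top UNIV. dist (sum ?a F) (infsum ?a UNIV) < e\<^sup>2"
    using assms by (intro tendstoD) auto
  then obtain F where F: "finite F" "dist (sum ?a F) (infsum ?a UNIV) < e\<^sup>2"
    unfolding eventually_finite_subsets_at_top by blast
  have "infsum ?a UNIV = infsum ?a F + infsum ?a (- F)"
    by (rule infsum_Un_disjoint[of ?a F "- F", simplified])
      (auto intro: summable_on_subset[OF summable_coeff] \<open>finite F\<close>)
  hence "(norm (restr (- F) x))\<^sup>2 < e\<^sup>2"
    using F by (simp add: norm_sq_restr dist_real_def)
  hence "norm (restr (- F) x) < e" using assms by (simp add: power_less_imp_less_base)
  thus ?thesis using F(1) that by blast
qed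

lemma restr_Compl: "x - restr F x = restr (- F) x"
  by (rule ell2_eqI) (simp add: coeff_restr)

lemma finite_support_dense:
  "\<exists>X. X \<longlonglongrightarrow> x \<and> (\<forall>n. finite {i. coeff (X n) i \<noteq> 0})"
proof -
  have "\<exists>F. finite F \<and> norm (restr (- F) x) < inverse (real (Suc n))" for n
    by (rule finite_approximation[of "inverse (real (Suc n))" x]) auto
  then obtain F where F: "\<And>n. finite (F n)" "\<And>n. norm (restr (- F n) x) < inverse (real (Suc n))"
    by metis
  have "(\<lambda>n. x - restr (F n) x) \<longlonglongrightarrow> 0"
    unfolding restr_Compl
    by (rule Lim_null_comparison[OF _ LIMSEQ_inverse_real_of_nat]) (use F in \<open>auto intro!: always_eventually less_imp_le\<close>)
  hence "(\<lambda>n. x - (x - restr (F n) x)) \<longlonglongrightarrow> x - 0" by (intro tendsto_intros)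
  moreover have "finite {i. coeff (restr (F n) x) i \<noteq> 0}" for n
    by (rule finite_subset[OF _ F(1)[of n]]) (auto simp: coeff_restr)
  ultimately have "(\<lambda>n. restr (F n) x) \<longlonglongrightarrow> x \<and> (\<forall>n. finite {i. coeff (restr (F n) x) i \<noteq> 0})"
    by simp
  thus ?thesis by (rule exI[of _ "\<lambda>n. restr (F n) x"])
qed

lemma finite_support_expand:
  assumes "finite {i. coeff x i \<noteq> 0}"
  shows "x = (\<Sum>i\<in>{i. coeff x i \<noteq> 0}. cscale (coeff x i) (unit i))"
  unfolding restr_finite[OF assms, symmetric] by (rule ell2_eqI) (simp add: coeff_restr)

lemma bounded_linear_eqI:
  assumes "bounded_linear A" "bounded_linear B"
    and eq: "\<And>c i. A (cscale c (unit i)) = B (cscale c (unit i))"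
  shows "A x = B x"
proof -
  obtain X where X: "X \<longlonglongrightarrow> x" "\<And>n. finite {i. coeff (X n) i \<noteq> 0}"
    using finite_support_dense[of x] by blast
  have "A (X n) = B (X n)" for n
    by (subst (1 2) finite_support_expand[OF X(2)[of n]])
      (simp add: linear_sum[OF bounded_linear.linear[OF assms(1)]]
        linear_sum[OF bounded_linear.linear[OF assms(2)]] eq)
  hence "(\<lambda>n. A (X n)) \<longlonglongrightarrow> B x"
    using bounded_linear.tendsto[OF assms(2) X(1)] by simp
  with bounded_linear.tendsto[OF assms(1) X(1)] show ?thesis by (rule LIMSEQ_unique)
qed

section \<open>Adjoints\<close>

lemma op_adjoint_eqI:
  assumes "\<And>x y. cinner (blinfun_apply S x) y = cinner x (blinfun_apply T y)"
  shows "op_adjoint T = S"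
  unfolding op_adjoint_def
proof (rule the_equality)
  fix S' assume S': "\<forall>x y. cinner (blinfun_apply S' x) y = cinner x (blinfun_apply T y)"
  show "S' = S"
  proof (rule blinfun_eqI, rule cinner_eqI)
    fix x y
    show "cinner y (blinfun_apply S' x) = cinner y (blinfun_apply S x)"
      using S' assms by (metis cinner_commute)
  qed
qed (use assms in blast)

text \<open>The coordinates of the adjoint are forced by testing against the standard basis; testing against
  finite parts of the resulting family bounds its partial sums.\<close>

lemma adjoint_exists:
  assumes T: "T \<in> bounded_ops"
  shows "\<exists>S. \<forall>x y. cinner (blinfun_apply S x) y = cinner x (blinfun_apply T y)"
proof -
  have Tc: "blinfun_apply T (cscale c x) = cscale c (blinfun_apply T x)" for c x
    using T by (simp add: bounded_ops_def)
  define s where "s x i = cinner (blinfun_apply T (unit i)) x" for x i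
  have s: "(\<Sum>i\<in>F. (cmod (s x i))\<^sup>2) \<le> (norm T * norm x)\<^sup>2" if "finite F" for x F
  proof -
    let ?z = "\<Sum>i\<in>F. cscale (s x i) (unit i)"
    let ?S = "\<Sum>i\<in>F. (cmod (s x i))\<^sup>2"
    have z: "coeff ?z i = (if i \<in> F then s x i else 0)" for i
      using that by (simp add: coeff_unit if_distrib sum.delta' cong: if_cong)
    have nz: "(norm ?z)\<^sup>2 = ?S"
    proof -
      have "(norm ?z)\<^sup>2 = (\<Sum>\<^sub>\<infinity>i\<in>F. (cmod (s x i))\<^sup>2)"
        unfolding norm_sq_coeff z by (rule infsum_cong_neutral) auto
      thus ?thesis using that by simp
    qed
    have "of_real ?S = cinner (blinfun_apply T ?z) x"
    proof -
      have "cinner x (blinfun_apply T ?z) = (\<Sum>i\<in>F. s x i * cnj (s x i))"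
        by (simp add: blinfun.sum_right Tc cinner_sum_right cinner_cscale_right s_def
            cinner_commute[of x])
      moreover have "cinner (blinfun_apply T ?z) x = cnj (cinner x (blinfun_apply T ?z))"
        by (rule cinner_commute)
      ultimately have "cinner (blinfun_apply T ?z) x = (\<Sum>i\<in>F. cnj (s x i) * s x i)"
        by simp
      thus ?thesis by (simp add: complex_norm_square[symmetric] mult.commute)
    qed
    hence "cmod (cinner (blinfun_apply T ?z) x) = cmod (of_real ?S)" by (rule arg_cong[OF sym])
    also have "\<dots> = ?S" unfolding norm_of_real by (rule abs_of_nonneg) (simp add: sum_nonneg)
    finally have "?S \<le> norm (blinfun_apply T ?z) * norm x"
      using cinner_bound[of "blinfun_apply T ?z" x] by (simp only:)
    also have "\<dots> \<le> (norm T * norm ?z) * norm x"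
      by (intro mult_right_mono norm_blinfun) auto
    finally have "norm ?z * norm ?z \<le> norm ?z * (norm T * norm x)"
      using nz by (simp add: power2_eq_square mult_ac)
    hence "norm ?z \<le> norm T * norm x"
      by (cases "norm ?z = 0") (auto dest: mult_left_le_imp_le)
    thus ?thesis unfolding nz[symmetric] by (intro power_mono) auto
  qed
  define S where "S x = Abs_ell2 (s x)" for x
  have S: "coeff (S x) i = s x i" for x i
    unfolding S_def by (rule coeff_Abs, rule sq_summable_bounded, rule s)
  have "bounded_linear S"
  proof (rule bounded_linear_intro[where K = "norm T"])
    show "norm (S x) \<le> norm x * norm T" for x
    proof -
      have "(norm (S x))\<^sup>2 \<le> (norm T * norm x)\<^sup>2"
        by (rule norm_sq_le) (use s in \<open>simp add: S\<close>)
      thus ?thesis by (simp add: mult.commute power2_le_iff_abs_le)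
    qed
  qed (auto intro!: ell2_eqI simp: S s_def cinner_add_right cinner_scaleR_right)
  hence app: "blinfun_apply (Blinfun S) = S" by (rule bounded_linear_Blinfun_apply)
  have "cinner (S x) y = cinner x (blinfun_apply T y)" for x y
  proof (rule bounded_linear_eqI[where x = y])
    show "bounded_linear (cinner (S x))" by (rule bounded_linear_cinner)
    show "bounded_linear (\<lambda>y. cinner x (blinfun_apply T y))"
      by (rule bounded_linear_compose[OF bounded_linear_cinner blinfun.bounded_linear_right])
    show "cinner (S x) (cscale c (unit i)) = cinner x (blinfun_apply T (cscale c (unit i)))" for c i
      by (subst cinner_commute) (simp add: cinner_cscale_left cinner_cscale_right cinner_unit_left S Tc s_def
          cinner_commute[of x])
  qed
  thus ?thesis using app by metis
qed

lemma op_adjoint: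
  assumes "T \<in> bounded_ops"
  shows "cinner (blinfun_apply (op_adjoint T) x) y = cinner x (blinfun_apply T y)"
  using adjoint_exists[OF assms] op_adjoint_eqI by metis

section \<open>Right multiplication by monomials and the commutant of the right shifts\<close>

lemma vacuum_eq_unit: "vacuum = unit []"
  by (rule ell2_eqI) (simp add: vacuum.rep_eq coeff_unit)

lemma Rshift_cscale: "blinfun_apply (Rshift k) (cscale c F) = cscale c (blinfun_apply (Rshift k) F)"
  by (rule ell2_eqI) (simp add: Rshift.rep_eq Rfun.rep_eq)

lemma Lshift_cscale: "blinfun_apply (Lshift k) (cscale c F) = cscale c (blinfun_apply (Lshift k) F)"
  by (rule ell2_eqI) (simp add: Lshift.rep_eq Lfun.rep_eq)

lemma Rshift_Lshift:
  "blinfun_apply (Rshift j) (blinfun_apply (Lshift k) F) = blinfun_apply (Lshift k) (blinfun_apply (Rshift j) F)"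
proof (rule ell2_eqI)
  fix \<gamma> :: "'a list"
  show "coeff (blinfun_apply (Rshift j) (blinfun_apply (Lshift k) F)) \<gamma>
      = coeff (blinfun_apply (Lshift k) (blinfun_apply (Rshift j) F)) \<gamma>"
  proof (cases "length \<gamma> \<le> 1")
    case True
    then consider "\<gamma> = []" | i where "\<gamma> = [i]" by (cases \<gamma>) auto
    thus ?thesis by cases (auto simp: Rshift.rep_eq Lshift.rep_eq Rfun.rep_eq Lfun.rep_eq)
  next
    case False
    then obtain i \<gamma>' where \<gamma>: "\<gamma> = i # \<gamma>'" "\<gamma>' \<noteq> []" by (cases \<gamma>) auto
    thus ?thesis by (auto simp: Rshift.rep_eq Lshift.rep_eq Rfun.rep_eq Lfun.rep_eq)
  qed
qed

text \<open>The operator \<^const>\<open>Rword\<close> multiplies by the last letter of its argument first, so right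
  multiplication by \<open>z\<^sup>\<beta>\<close> belongs to the reversed word.\<close>

definition rmon :: "'d list \<Rightarrow> 'd fock \<Rightarrow> 'd fock" where
  "rmon \<beta> F = blinfun_apply (Rword (rev \<beta>)) F"

lemma Rword_append: "blinfun_apply (Rword (\<alpha> @ \<beta>)) F = blinfun_apply (Rword \<alpha>) (blinfun_apply (Rword \<beta>) F)"
  by (induction \<alpha>) auto

lemma rmon_Nil [simp]: "rmon [] F = F"
  by (simp add: rmon_def)

lemma rmon_Cons: "rmon (k # \<beta>) F = rmon \<beta> (blinfun_apply (Rshift k) F)"
  by (simp add: rmon_def Rword_append)

lemma bounded_linear_rmon: "bounded_linear (rmon \<beta>)"
  unfolding rmon_def[abs_def] by (rule blinfun.bounded_linear_right)

lemma coeff_rmon [simp]: "coeff (rmon \<beta> F) (\<alpha> @ \<beta>) = coeff F \<alpha>"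
proof (induction \<beta> arbitrary: F \<alpha>)
  case (Cons k \<beta>)
  from Cons[of "blinfun_apply (Rshift k) F" "\<alpha> @ [k]"] show ?case
    by (simp add: rmon_Cons Rshift.rep_eq Rfun.rep_eq)
qed simp

lemma coeff_rmon_eq_0:
  assumes "\<And>\<alpha>. \<gamma> \<noteq> \<alpha> @ \<beta>"
  shows "coeff (rmon \<beta> F) \<gamma> = 0"
  using assms
proof (induction \<beta> arbitrary: F)
  case Nil
  from Nil[of \<gamma>] show ?case by simp
next
  case (Cons k \<beta>)
  show ?case
  proof (cases "\<exists>\<alpha>. \<gamma> = \<alpha> @ \<beta>")
    case True
    then obtain \<alpha> where \<gamma>: "\<gamma> = \<alpha> @ \<beta>" by blast
    have "\<alpha> = [] \<or> last \<alpha> \<noteq> k"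
    proof (rule ccontr)
      assume "\<not> ?thesis"
      hence "\<gamma> = butlast \<alpha> @ k # \<beta>"
        unfolding \<gamma> by (cases \<alpha> rule: rev_cases) auto
      thus False using Cons.prems by blast
    qed
    thus ?thesis by (auto simp: rmon_Cons \<gamma> Rshift.rep_eq Rfun.rep_eq)
  next
    case False
    thus ?thesis unfolding rmon_Cons by (intro Cons.IH) blast
  qed
qed

lemma rmon_cases:
  obtains \<alpha> where "\<gamma> = \<alpha> @ \<beta>" "\<And>F. coeff (rmon \<beta> F) \<gamma> = coeff F \<alpha>"
  | "\<And>\<alpha>. \<gamma> \<noteq> \<alpha> @ \<beta>" "\<And>F. coeff (rmon \<beta> F) \<gamma> = 0"
  using coeff_rmon coeff_rmon_eq_0 by metis

lemma rmon_unit: "rmon \<beta> (unit \<alpha>) = unit (\<alpha> @ \<beta>)"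
proof (rule ell2_eqI)
  fix \<gamma> show "coeff (rmon \<beta> (unit \<alpha>)) \<gamma> = coeff (unit (\<alpha> @ \<beta>)) \<gamma>"
    by (rule rmon_cases[of \<gamma> \<beta>]) (auto simp: coeff_unit)
qed

lemma cinner_rmon_expand: "cinner k (rmon \<beta> F) = (\<Sum>\<^sub>\<infinity>\<alpha>. cnj (coeff k (\<alpha> @ \<beta>)) * coeff F \<alpha>)"
proof -
  have inj: "inj (\<lambda>\<alpha>. \<alpha> @ \<beta>)" by (auto simp: inj_on_def)
  have "cinner k (rmon \<beta> F) = (\<Sum>\<^sub>\<infinity>\<gamma>\<in>range (\<lambda>\<alpha>. \<alpha> @ \<beta>). cnj (coeff k \<gamma>) * coeff (rmon \<beta> F) \<gamma>)"
    unfolding cinner_def by (rule infsum_cong_neutral) (auto intro!: coeff_rmon_eq_0)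
  also have "\<dots> = (\<Sum>\<^sub>\<infinity>\<alpha>. cnj (coeff k (\<alpha> @ \<beta>)) * coeff F \<alpha>)"
    by (subst infsum_reindex[OF inj]) (simp add: o_def)
  finally show ?thesis .
qed

lemma nc_degree_less:
  assumes "nc_polynomial x" and "length \<alpha> > nc_degree x"
  shows "coeff x \<alpha> = 0"
proof (rule ccontr)
  assume "coeff x \<alpha> \<noteq> 0"
  hence "length \<alpha> \<le> nc_degree x"
    unfolding nc_degree_def using assms(1) by (intro Max_ge) (auto simp: nc_polynomial_def)
  thus False using assms(2) by simp
qed

lemma nc_outer_iff: "nc_outer f \<longleftrightarrow> closure (cspan (range (\<lambda>\<beta>. rmon \<beta> f))) = UNIV"
proof -
  have "range (\<lambda>\<alpha>. blinfun_apply (Rword \<alpha>) f) = range (\<lambda>\<beta>. rmon \<beta> f)"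
    unfolding rmon_def image_def by (auto, metis rev_rev_ident)
  thus ?thesis by (simp add: nc_outer_def)
qed

text \<open>The right translates of an outer series span a dense subspace, and \<open>\<langle>k, \<sqdot>\<rangle>\<close> is continuous.\<close>

lemma outer_functional_eq_0:
  assumes "nc_outer f" and "\<And>\<beta>. cinner k (rmon \<beta> f) = 0"
  shows "cinner k F = 0"
proof -
  have "closed {F. cinner k F = 0}"
    by (intro closed_Collect_eq continuous_intros bounded_linear.continuous_on[OF bounded_linear_cinner])
  moreover have "cinner k (\<Sum>x\<in>A. cscale (c x) x) = 0" if "A \<subseteq> range (\<lambda>\<beta>. rmon \<beta> f)" for A c
    unfolding cinner_sum_right cinner_cscale_right using that assms(2) by (intro sum.neutral) auto
  hence "cspan (range (\<lambda>\<beta>. rmon \<beta> f)) \<subseteq> {F. cinner k F = 0}"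
    by (auto simp: cspan_def)
  ultimately have "closure (cspan (range (\<lambda>\<beta>. rmon \<beta> f))) \<subseteq> {F. cinner k F = 0}"
    by (rule closure_minimal[rotated])
  thus ?thesis using assms(1) by (auto simp: nc_outer_iff)
qed

text \<open>Otherwise the coefficient at the empty word would vanish on all right translates, hence on \<open>1\<close>.\<close>

lemma outer_constant_coeff:
  assumes "nc_outer f"
  shows "coeff f [] \<noteq> 0"
proof
  assume "coeff f [] = 0"
  hence "coeff (rmon \<beta> f) [] = 0" for \<beta>
    by (rule_tac rmon_cases[of "[]" \<beta>]) auto
  hence "cinner (unit []) (rmon \<beta> f) = 0" for \<beta>
    by (simp add: cinner_unit_left)
  from outer_functional_eq_0[OF assms this, of "unit []"] show False
    by (simp add: cinner_unit_left coeff_unit)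
qed

definition right_commutant :: "('d fock \<Rightarrow>\<^sub>L 'd fock) set" where
  "right_commutant = {T \<in> bounded_ops.
     \<forall>k F. blinfun_apply T (blinfun_apply (Rshift k) F) = blinfun_apply (Rshift k) (blinfun_apply T F)}"

lemma Rshift_bounded_ops: "Rshift k \<in> bounded_ops"
  by (simp add: bounded_ops_def Rshift_cscale)

text \<open>Commuting with complex scalars and with the right shifts are linear conditions on the matrix
  entries of an operator once the shift is moved to the other side of the inner product; this is why
  they pass to weak limits.\<close>

lemma closedin_right_commutant: "closedin weak_operator_topology right_commutant"
proof -
  define V :: "('a fock \<times> 'a fock \<Rightarrow> complex) set" where
    "V = {\<phi>. (\<forall>x y c. \<phi> (x, cscale c y) = c * \<phi> (x, y)) \<and>
             (\<forall>x y k. \<phi> (x, blinfun_apply (Rshift k) y) = \<phi> (blinfun_apply (op_adjoint (Rshift k)) x, y))}"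
  have coord: "continuous_on UNIV (\<lambda>\<phi> :: 'a fock \<times> 'a fock \<Rightarrow> complex. \<phi> i)" for i
    by (rule continuous_on_product_coordinates)
  have "closed V"
    unfolding V_def
    by (intro closed_Collect_conj closed_Collect_all closed_Collect_eq continuous_on_mult
        continuous_on_const coord)
  let ?\<Phi> = "\<lambda>(T :: 'a fock \<Rightarrow>\<^sub>L 'a fock) (x, y). cinner x (blinfun_apply T y)"
  have "right_commutant = ?\<Phi> -` V"
  proof (rule Set.set_eqI)
    fix T :: "'a fock \<Rightarrow>\<^sub>L 'a fock"
    have "T \<in> ?\<Phi> -` V \<longleftrightarrow>
       (\<forall>c y. \<forall>x. cinner x (blinfun_apply T (cscale c y)) = cinner x (cscale c (blinfun_apply T y))) \<and>
       (\<forall>k y. \<forall>x. cinner x (blinfun_apply T (blinfun_apply (Rshift k) y))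
              = cinner x (blinfun_apply (Rshift k) (blinfun_apply T y)))"
      unfolding V_def vimage_def mem_Collect_eq prod.case cinner_cscale_right
        op_adjoint[OF Rshift_bounded_ops] by blast
    also have "\<dots> \<longleftrightarrow> T \<in> right_commutant"
      unfolding right_commutant_def bounded_ops_def mem_Collect_eq cinner_eq_iff ..
    finally show "T \<in> right_commutant \<longleftrightarrow> T \<in> ?\<Phi> -` V" ..
  qed
  moreover have "closedin weak_operator_topology (?\<Phi> -` V)"
    unfolding closedin_def
  proof
    show "?\<Phi> -` V \<subseteq> topspace weak_operator_topology"
      by (simp add: weak_operator_topology_def topspace_pullback_topology)
    have "topspace weak_operator_topology - ?\<Phi> -` V = ?\<Phi> -` (- V) \<inter> UNIV"
      by (auto simp: weak_operator_topology_def topspace_pullback_topology)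
    moreover have "openin euclidean (- V)" using \<open>closed V\<close> by (simp add: open_Compl)
    ultimately show "openin weak_operator_topology (topspace weak_operator_topology - ?\<Phi> -` V)"
      unfolding weak_operator_topology_def openin_pullback_topology by blast
  qed
  ultimately show ?thesis by simp
qed

lemma Hinf_algebra_subset: "Hinf_algebra \<subseteq> right_commutant"
  unfolding Hinf_algebra_def
proof (rule hull_minimal)
  show "range Lshift \<subseteq> (right_commutant :: ('a fock \<Rightarrow>\<^sub>L 'a fock) set)"
    by (auto simp: right_commutant_def bounded_ops_def Lshift_cscale Rshift_Lshift)
  show "unital_op_algebra (right_commutant :: ('a fock \<Rightarrow>\<^sub>L 'a fock) set) \<and> closedin weak_operator_topology (right_commutant :: ('a fock \<Rightarrow>\<^sub>L 'a fock) set)"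
  proof
    show "unital_op_algebra (right_commutant :: ('a fock \<Rightarrow>\<^sub>L 'a fock) set)"
      by (auto simp: unital_op_algebra_def right_commutant_def bounded_ops_def blinfun.add_left
          blinfun.add_right cscale_add cscaleL.rep_eq Rshift_cscale mult.commute)
  qed (rule closedin_right_commutant)
qed

lemma commutant_rmon:
  assumes "T \<in> right_commutant"
  shows "blinfun_apply T (rmon \<beta> F) = rmon \<beta> (blinfun_apply T F)"
  using assms by (induction \<beta> arbitrary: F) (auto simp: rmon_Cons right_commutant_def)

lemma commutant_unit:
  assumes "T \<in> right_commutant"
  shows "blinfun_apply T (unit \<beta>) = rmon \<beta> (blinfun_apply T vacuum)"
  using commutant_rmon[OF assms, of \<beta> "unit []"] by (simp add: rmon_unit vacuum_eq_unit)

text \<open>Operators in the commutant are left multiplications, determined by \<open>T 1\<close> because \<open>T z\<^sup>\<beta> = (T 1) z\<^sup>\<beta>\<close>.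
  So the operator belonging to a series is unique, which gives \<^const>\<open>op_of\<close> its meaning.\<close>

lemma commutant_eqI:
  assumes "T \<in> right_commutant" "S \<in> right_commutant"
    and "blinfun_apply T vacuum = blinfun_apply S vacuum"
  shows "T = S"
proof (rule blinfun_eqI,
    rule bounded_linear_eqI[where A = "blinfun_apply T" and B = "blinfun_apply S"])
  fix c and \<beta> :: "'a list"
  show "blinfun_apply T (cscale c (unit \<beta>)) = blinfun_apply S (cscale c (unit \<beta>))"
    using assms commutant_unit[of T] commutant_unit[of S]
    by (simp add: right_commutant_def bounded_ops_def)
qed (rule blinfun.bounded_linear_right)+

lemma op_of_Hinf:
  assumes "\<Theta> \<in> Hinf"
  shows "op_of \<Theta> \<in> Hinf_algebra \<and> blinfun_apply (op_of \<Theta>) vacuum = \<Theta>"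
proof -
  obtain T where T: "T \<in> Hinf_algebra" "blinfun_apply T vacuum = \<Theta>"
    using assms by (auto simp: Hinf_def)
  show ?thesis unfolding op_of_def
  proof (rule theI)
    show "T \<in> Hinf_algebra \<and> blinfun_apply T vacuum = \<Theta>" using T by simp
    fix S assume "S \<in> Hinf_algebra \<and> blinfun_apply S vacuum = \<Theta>"
    thus "S = T" using T Hinf_algebra_subset by (intro commutant_eqI) auto
  qed
qed

lemma cinner_rmon_low_degree:
  assumes "\<And>\<alpha>. length \<alpha> > N \<Longrightarrow> coeff x \<alpha> = 0" and "length \<beta> > N"
  shows "cinner (rmon \<beta> F) x = 0"
proof -
  have "cnj (coeff (rmon \<beta> F) \<gamma>) * coeff x \<gamma> = 0" for \<gamma>
    by (rule rmon_cases[of \<gamma> \<beta>]) (use assms in auto)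
  thus ?thesis unfolding cinner_def by (intro infsum_0) blast
qed

section \<open>Isometric left multipliers\<close>

locale isometric_multiplier =
  fixes T :: "'d::finite fock \<Rightarrow>\<^sub>L 'd fock" and \<Theta> :: "'d fock"
  assumes T_commutes: "T \<in> right_commutant" and T_vacuum: "blinfun_apply T vacuum = \<Theta>"
    and T_norm: "norm (blinfun_apply T F) = norm F"

lemma nc_inner_isometric_multiplier:
  assumes "nc_inner \<Theta>"
  shows "isometric_multiplier (op_of \<Theta>) \<Theta>"
  using assms op_of_Hinf[of \<Theta>] Hinf_algebra_subset by unfold_locales (auto simp: nc_inner_def)

context isometric_multiplier
begin

lemma T_cscale: "blinfun_apply T (cscale c F) = cscale c (blinfun_apply T F)"
  using T_commutes by (simp add: right_commutant_def bounded_ops_def)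


lemma T_unit: "blinfun_apply T (unit \<beta>) = rmon \<beta> \<Theta>"
  using commutant_unit[OF T_commutes] T_vacuum by simp

lemma T_cinner: "cinner (blinfun_apply T F) (blinfun_apply T G) = cinner F G"
  by (rule cinner_isometry[OF blinfun.bounded_linear_right T_cscale T_norm])

lemma T_finite_support:
  assumes "finite {\<beta>. coeff q \<beta> \<noteq> 0}"
  shows "blinfun_apply T q = (\<Sum>\<beta>\<in>{\<beta>. coeff q \<beta> \<noteq> 0}. cscale (coeff q \<beta>) (rmon \<beta> \<Theta>))"
  by (subst finite_support_expand[OF assms]) (simp add: blinfun.sum_right T_cscale T_unit)

text \<open>The coefficient of \<open>f\<close> at \<open>\<beta>\<close> is \<open>\<langle>T z\<^sup>\<beta>, T f\<rangle> = \<langle>\<Theta> z\<^sup>\<beta>, T f\<rangle>\<close>, and \<open>\<Theta> z\<^sup>\<beta>\<close> lives on words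
  that are at least as long as \<open>\<beta>\<close>. This is why the outer factor of a polynomial is a polynomial of no
  larger degree.\<close>

lemma quotient_degree:
  assumes "\<And>\<alpha>. length \<alpha> > N \<Longrightarrow> coeff (blinfun_apply T f) \<alpha> = 0" and "length \<beta> > N"
  shows "coeff f \<beta> = 0"
proof -
  have "coeff f \<beta> = cinner (rmon \<beta> \<Theta>) (blinfun_apply T f)"
    by (simp add: T_unit[symmetric] T_cinner cinner_unit_left)
  thus ?thesis using cinner_rmon_low_degree[OF assms] by simp
qed

text \<open>The coefficient of \<open>g = T\<^sup>* x\<close> at \<open>\<beta>\<close> is \<open>\<langle>\<Theta> z\<^sup>\<beta>, x\<rangle>\<close>, which vanishes when \<open>\<beta>\<close> is longer than the degree
  of \<open>x\<close>; this finite sum replaces the adjoint.\<close>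

lemma polynomial_projection:
  assumes "nc_polynomial x"
  obtains g where "nc_polynomial g" "\<And>F. cinner (x - blinfun_apply T g) (blinfun_apply T F) = 0"
proof -
  obtain N where N: "\<And>\<alpha>. length \<alpha> > N \<Longrightarrow> coeff x \<alpha> = 0"
  proof -
    show ?thesis by (rule that) (rule nc_degree_less[OF assms])
  qed
  let ?W = "{\<beta> :: 'd list. length \<beta> \<le> N}"
  have fin: "finite ?W" using finite_lists_length_le[of "UNIV :: 'd set" N] by simp
  define g where "g = (\<Sum>\<beta>\<in>?W. cscale (cinner (rmon \<beta> \<Theta>) x) (unit \<beta>))"
  have g: "coeff g \<beta> = cinner (rmon \<beta> \<Theta>) x" for \<beta>
    using cinner_rmon_low_degree[OF N, where \<beta> = \<beta> and F = \<Theta>] fin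
    by (auto simp: g_def coeff_unit if_distrib sum.delta cong: if_cong)
  have "{\<beta>. coeff g \<beta> \<noteq> 0} \<subseteq> ?W"
    using cinner_rmon_low_degree[OF N] unfolding g by (auto simp: not_less[symmetric])
  hence "nc_polynomial g" unfolding nc_polynomial_def using fin by (rule finite_subset)
  moreover have "cinner (x - blinfun_apply T g) (blinfun_apply T F) = 0" for F
  proof (rule bounded_linear_eqI[where x = F and B = "\<lambda>_. 0"])
    show "bounded_linear (\<lambda>F. cinner (x - blinfun_apply T g) (blinfun_apply T F))"
      by (rule bounded_linear_compose[OF bounded_linear_cinner blinfun.bounded_linear_right])
    fix c and \<beta> :: "'d list"
    have "cinner (blinfun_apply T (unit \<beta>)) (x - blinfun_apply T g) = cinner (rmon \<beta> \<Theta>) x - coeff g \<beta>"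
      unfolding cinner_minus_right T_cinner by (simp add: T_unit cinner_unit_left)
    hence "cinner (x - blinfun_apply T g) (blinfun_apply T (unit \<beta>)) = 0"
      by (subst cinner_commute) (simp add: g)
    thus "cinner (x - blinfun_apply T g) (blinfun_apply T (cscale c (unit \<beta>))) = 0"
      by (simp add: T_cscale cinner_cscale_right)
  qed simp
  ultimately show ?thesis by (rule that)
qed

text \<open>The vectors \<open>\<Theta> z\<^sup>\<beta> = T z\<^sup>\<beta>\<close> span a dense subspace of the range.\<close>

lemma range_functional_eq_0:
  assumes "\<And>\<beta>. cinner k (rmon \<beta> \<Theta>) = 0"
  shows "cinner k (blinfun_apply T F) = 0"
proof (rule bounded_linear_eqI[where x = F and B = "\<lambda>_. 0"])
  show "bounded_linear (\<lambda>F. cinner k (blinfun_apply T F))"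
    by (rule bounded_linear_compose[OF bounded_linear_cinner blinfun.bounded_linear_right])
qed (simp_all add: T_cscale T_unit cinner_cscale_right assms)

text \<open>The vectors \<open>x - T T\<^sup>* x\<close>, with \<open>x\<close> a polynomial, are dense in the orthogonal complement of the
  closed range of \<open>T\<close>. Concretely, when polynomials \<open>x\<^sub>n\<close> approximate \<open>h\<close>, the vectors \<open>T T\<^sup>* x\<^sub>n\<close>
  converge to some \<open>T g\<close>, and \<open>h - T g\<close> is orthogonal both to \<open>h\<close> and to \<open>T g\<close>, so it is zero.\<close>

lemma mem_rangeI:
  assumes test: "\<And>x g. nc_polynomial x \<Longrightarrow> nc_polynomial g \<Longrightarrow>
      (\<And>F. cinner (x - blinfun_apply T g) (blinfun_apply T F) = 0) \<Longrightarrow>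
      cinner (x - blinfun_apply T g) h = 0"
  shows "h \<in> range (blinfun_apply T)"
proof -
  obtain X where X: "X \<longlonglongrightarrow> h" "\<And>n. nc_polynomial (X n)"
    using finite_support_dense[of h] unfolding nc_polynomial_def by blast
  have "\<exists>g. nc_polynomial g \<and> (\<forall>F. cinner (X n - blinfun_apply T g) (blinfun_apply T F) = 0)" for n
    using polynomial_projection[OF X(2)[of n]] by metis
  then obtain G where G: "\<And>n. nc_polynomial (G n)"
      "\<And>n F. cinner (X n - blinfun_apply T (G n)) (blinfun_apply T F) = 0"
    by metis
  have diff: "norm (G m - G n) \<le> norm (X m - X n)" for m n
  proof -
    let ?u = "blinfun_apply T (G m - G n)"
    have u: "?u = blinfun_apply T (G m) - blinfun_apply T (G n)" by (rule blinfun.diff_right)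
    have "cinner (X m - X n) ?u = cinner ?u ?u
        + (cinner (X m - blinfun_apply T (G m)) ?u - cinner (X n - blinfun_apply T (G n)) ?u)"
      by (subst (2) u) (simp add: cinner_minus_left)
    hence "cinner (X m - X n) ?u = of_real ((norm ?u)\<^sup>2)"
      by (simp add: G(2) cinner_self)
    hence "(norm ?u)\<^sup>2 \<le> norm (X m - X n) * norm ?u"
      using cinner_bound[of "X m - X n" ?u] by (simp add: norm_power)
    hence "norm ?u \<le> norm (X m - X n)"
      by (cases "norm ?u = 0") (auto simp: power2_eq_square)
    thus ?thesis by (simp add: T_norm)
  qed
  have "Cauchy G"
  proof (rule CauchyI)
    fix e :: real assume "e > 0"
    then obtain M where "\<And>m n. m \<ge> M \<Longrightarrow> n \<ge> M \<Longrightarrow> norm (X m - X n) < e"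
      using CauchyD[OF LIMSEQ_imp_Cauchy[OF X(1)]] by blast
    thus "\<exists>M. \<forall>m\<ge>M. \<forall>n\<ge>M. norm (G m - G n) < e"
      using diff le_less_trans by blast
  qed
  then obtain g where g: "G \<longlonglongrightarrow> g"
    unfolding Cauchy_convergent_iff convergent_def by blast
  have lim: "(\<lambda>n. X n - blinfun_apply T (G n)) \<longlonglongrightarrow> h - blinfun_apply T g"
    by (intro tendsto_intros X g)
  have "cinner (X n - blinfun_apply T (G n)) h = 0" for n
    by (rule test[OF X(2) G(1) G(2)])
  with tendsto_cinner_left[OF lim, of h] have 1: "cinner (h - blinfun_apply T g) h = 0"
    using LIMSEQ_unique[OF _ tendsto_const[of 0]] by simp
  from tendsto_cinner_left[OF lim, of "blinfun_apply T g"]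
  have 2: "cinner (h - blinfun_apply T g) (blinfun_apply T g) = 0"
    using LIMSEQ_unique[OF _ tendsto_const[of 0]] by (simp add: G(2))
  have "cinner (h - blinfun_apply T g) (h - blinfun_apply T g) = 0"
    using 1 2 by (simp add: cinner_minus_right)
  hence "h = blinfun_apply T g" by (simp add: cinner_self)
  thus ?thesis by blast
qed

end

section \<open>Geometric decay of rational square-summable series\<close>

text \<open>The product \<open>F q\<close>, meaningful for polynomials \<open>q\<close> only.\<close>

definition rmul :: "'d fock \<Rightarrow> 'd fock \<Rightarrow> 'd fock" where
  "rmul q F = (\<Sum>\<beta>\<in>{\<beta>. coeff q \<beta> \<noteq> 0}. cscale (coeff q \<beta>) (rmon \<beta> F))"

lemma linear_rmul: "linear (rmul q)"
proof (rule linearI)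
  interpret rmon: bounded_linear "rmon \<beta> :: 'a fock \<Rightarrow> 'a fock" for \<beta> by (rule bounded_linear_rmon)
  fix x y :: "'a fock" and r :: real
  show "rmul q (x + y) = rmul q x + rmul q y"
    by (simp add: rmul_def rmon.add cscale_add sum.distrib)
  show "rmul q (r *\<^sub>R x) = r *\<^sub>R rmul q x"
    by (simp add: rmul_def rmon.scaleR cscale_scaleR scaleR_sum_right)
qed

lemma coeff_rmul: "coeff (rmul q F) \<gamma> = (\<Sum>\<beta>\<in>{\<beta>. coeff q \<beta> \<noteq> 0}. coeff q \<beta> * coeff (rmon \<beta> F) \<gamma>)"
  by (simp add: rmul_def)

text \<open>Induction on the length of the word recovers the coefficients of \<open>F\<close> from those of the product: the
  constant term of \<open>q\<close> multiplies the coefficient in question, and all other terms involve coefficients of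
  \<open>F\<close> at shorter words.\<close>

lemma rmul_eq_0:
  assumes "nc_polynomial q" "coeff q [] \<noteq> 0" "rmul q F = 0"
  shows "F = 0"
proof (rule ell2_eqI)
  fix \<gamma>
  show "coeff F \<gamma> = coeff 0 \<gamma>"
  proof (induction \<gamma> rule: length_induct)
    case (1 \<gamma>)
    let ?S = "{\<beta>. coeff q \<beta> \<noteq> 0}"
    have fin: "finite ?S" using assms(1) by (simp add: nc_polynomial_def)
    have low: "coeff (rmon \<beta> F) \<gamma> = 0" if "\<beta> \<noteq> []" for \<beta>
      by (rule rmon_cases[of \<gamma> \<beta>]) (use that 1 in auto)
    have "0 = coeff (rmul q F) \<gamma>" using assms(3) by simp
    also have "\<dots> = coeff q [] * coeff F \<gamma> + (\<Sum>\<beta>\<in>?S - {[]}. coeff q \<beta> * coeff (rmon \<beta> F) \<gamma>)"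
      unfolding coeff_rmul using fin assms(2) by (subst sum.remove[of _ "[]"]) auto
    also have "\<dots> = coeff q [] * coeff F \<gamma>" by (simp add: low)
    finally show ?case using assms(2) by simp
  qed
qed

lift_definition bshift :: "'d \<Rightarrow> 'd fock \<Rightarrow> 'd fock" is "\<lambda>k F \<gamma>. F (k # \<gamma>)"
proof -
  fix k :: 'd and F :: "'d list \<Rightarrow> complex" assume F: "sq_summable F"
  have inj: "inj ((#) k)" by auto
  have "(\<lambda>\<gamma>. (cmod (F \<gamma>))\<^sup>2) summable_on range ((#) k)"
    by (rule summable_on_subset[OF F[unfolded sq_summable_def]]) auto
  thus "sq_summable (\<lambda>\<gamma>. F (k # \<gamma>))"
    unfolding sq_summable_def summable_on_reindex[OF inj] by (simp add: o_def)
qed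

lemma coeff_bshift [simp]: "coeff (bshift k F) \<gamma> = coeff F (k # \<gamma>)"
  by (simp add: bshift.rep_eq)

text \<open>The product rule for the backward left shift; the last term arises when the removed letter belongs
  to the monomial itself.\<close>

lemma bshift_rmon:
  "coeff (rmon \<beta> F) (k # \<gamma>) = coeff (rmon \<beta> (bshift k F)) \<gamma> + coeff F [] * coeff (unit \<beta>) (k # \<gamma>)"
proof (cases "\<exists>\<alpha>. \<gamma> = \<alpha> @ \<beta>")
  case True
  then obtain \<alpha> where \<gamma>: "\<gamma> = \<alpha> @ \<beta>" by blast
  have "k # \<gamma> \<noteq> \<beta>" using arg_cong[of "k # \<gamma>" \<beta> length] unfolding \<gamma> by auto
  thus ?thesis using coeff_rmon[of \<beta> F "k # \<alpha>"] by (simp add: \<gamma> coeff_unit)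
next
  case False
  hence 0: "coeff (rmon \<beta> (bshift k F)) \<gamma> = 0" by (intro coeff_rmon_eq_0) blast
  show ?thesis
  proof (cases "k # \<gamma> = \<beta>")
    case True
    thus ?thesis using coeff_rmon[of \<beta> F "[]"] 0 by (simp add: coeff_unit)
  next
    case neq: False
    have "k # \<gamma> \<noteq> \<alpha> @ \<beta>" for \<alpha> using False neq by (cases \<alpha>) auto
    thus ?thesis using 0 neq by (simp add: coeff_unit coeff_rmon_eq_0)
  qed
qed

lemma bshift_rmul:
  assumes "nc_polynomial q"
  shows "coeff (rmul q (bshift k F)) \<gamma> = coeff (rmul q F) (k # \<gamma>) - coeff F [] * coeff q (k # \<gamma>)"
proof -
  let ?S = "{\<beta>. coeff q \<beta> \<noteq> 0}"
  have fin: "finite ?S" using assms by (simp add: nc_polynomial_def)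
  have "coeff q (k # \<gamma>) = (\<Sum>\<beta>\<in>?S. coeff q \<beta> * coeff (unit \<beta>) (k # \<gamma>))"
    by (subst finite_support_expand[OF fin]) simp
  thus ?thesis
    by (simp add: coeff_rmul bshift_rmon distrib_left sum.distrib sum_distrib_left mult_ac)
qed

definition tail :: "nat \<Rightarrow> 'd fock \<Rightarrow> 'd fock" where
  "tail m F = restr {\<gamma>. m \<le> length \<gamma>} F"

lemma coeff_tail: "coeff (tail m F) \<gamma> = (if m \<le> length \<gamma> then coeff F \<gamma> else 0)"
  by (simp add: tail_def coeff_restr)

lemma linear_tail: "linear (tail m)"
  unfolding tail_def[abs_def] by (rule linear_restr)

lemma tail_0 [simp]: "tail 0 F = F"
  by (rule ell2_eqI) (simp add: coeff_tail)

lemma norm_tail_antimono: "m \<le> n \<Longrightarrow> norm (tail n F) \<le> norm (tail m F)"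
  unfolding tail_def by (rule norm_restr_mono) auto

text \<open>A word of length greater than \<open>m\<close> is a letter followed by a word of length at least \<open>m\<close>, and the
  ranges of the left shifts are orthogonal.\<close>

lemma tail_Suc_expand:
  fixes F :: "'d::finite fock"
  shows "tail (Suc m) F = (\<Sum>k\<in>UNIV. Lfun k (tail m (bshift k F)))"
proof (rule ell2_eqI)
  fix \<gamma> :: "'d list"
  show "coeff (tail (Suc m) F) \<gamma> = coeff (\<Sum>k\<in>UNIV. Lfun k (tail m (bshift k F))) \<gamma>"
    by (cases \<gamma>) (simp_all add: coeff_tail Lfun.rep_eq sum.delta)
qed

lemma tail_Suc:
  fixes F :: "'d::finite fock"
  shows "(norm (tail (Suc m) F))\<^sup>2 = (\<Sum>k\<in>UNIV. (norm (tail m (bshift k F)))\<^sup>2)"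
proof -
  let ?f = "\<lambda>k. Lfun k (tail m (bshift k F))"
  have "pairwise (\<lambda>i j. Linear_Algebra.orthogonal (?f i) (?f j)) UNIV"
  proof (rule pairwiseI)
    fix i j :: 'd assume "i \<noteq> j"
    hence "cnj (coeff (?f i) \<gamma>) * coeff (?f j) \<gamma> = 0" for \<gamma>
      by (simp add: Lfun.rep_eq)
    hence "cinner (?f i) (?f j) = 0" unfolding cinner_def by (intro infsum_0) blast
    thus "Linear_Algebra.orthogonal (?f i) (?f j)"
      by (simp add: Linear_Algebra.orthogonal_def inner_ell2_def)
  qed
  from norm_sum_Pythagorean[OF finite this] show ?thesis
    by (simp add: tail_Suc_expand norm_Lfun)
qed

lemma tail_eventually_small:
  assumes "e > 0"
  shows "\<exists>K. \<forall>m\<ge>K. norm (tail m F) < e"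
proof -
  obtain A where A: "finite A" "norm (restr (- A) F) < e"
    using finite_approximation[OF assms] by blast
  have "norm (tail m F) < e" if "m \<ge> Suc (Max (insert 0 (length ` A)))" for m
  proof -
    have "length \<gamma> < m" if "\<gamma> \<in> A" for \<gamma>
    proof -
      have "length \<gamma> \<le> Max (insert 0 (length ` A))"
        using A(1) that by (intro Max_ge) auto
      thus ?thesis using \<open>m \<ge> _\<close> by simp
    qed
    hence "{\<gamma>. m \<le> length \<gamma>} \<subseteq> - A" by force
    from norm_restr_mono[OF this, of F] show ?thesis using A(2) by (simp add: tail_def)
  qed
  thus ?thesis by blast
qed

text \<open>Tails tend to zero pointwise, hence uniformly on the unit ball of a finite-dimensional space. An
  orthogonal basis makes this explicit, the coordinates being bounded by the norm.\<close>

lemma tail_uniformly_small: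
  fixes B :: "'a fock set"
  assumes "finite B" "e > 0"
  shows "\<exists>K. \<forall>g\<in>span B. norm (tail K g) \<le> e * norm g"
proof -
  obtain C where C: "finite C" "span C = span B" "pairwise Linear_Algebra.orthogonal C"
    using basis_orthogonal[OF assms(1)] by blast
  define \<delta> where "\<delta> = e / real (card C + 1)"
  have \<delta>: "\<delta> > 0" "real (card C) * \<delta> \<le> e" using assms(2) by (auto simp: \<delta>_def field_simps)
  have "\<exists>K. \<forall>m\<ge>K. norm (tail m c) \<le> \<delta> * norm c" for c :: "'a fock"
  proof (cases "c = 0")
    case True
    thus ?thesis by (simp add: linear_0[OF linear_tail])
  next
    case False
    hence "\<delta> * norm c > 0" using \<delta>(1) by simp
    from tail_eventually_small[OF this, of c] show ?thesis by (meson less_imp_le)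
  qed
  then obtain k :: "'a fock \<Rightarrow> nat" where k: "\<And>c m. m \<ge> k c \<Longrightarrow> norm (tail m c) \<le> \<delta> * norm c" by metis
  define K where "K = Max (insert 0 (k ` C))"
  have K: "norm (tail K c) \<le> \<delta> * norm c" if "c \<in> C" for c
    by (rule k) (use that C(1) in \<open>auto simp: K_def\<close>)
  have "norm (tail K g) \<le> e * norm g" if "g \<in> span B" for g
  proof -
    from that have "g \<in> span C" using C(2) by simp
    then obtain u where g: "g = (\<Sum>c\<in>C. u c *\<^sub>R c)"
      unfolding span_finite[OF C(1)] by auto
    have coord: "\<bar>u c\<bar> * norm c \<le> norm g" if c: "c \<in> C" for c
    proof -
      have "inner g c = (\<Sum>a\<in>C. u a * inner a c)"
        unfolding g by (simp add: inner_sum_left)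
      also have "\<dots> = u c * inner c c + (\<Sum>a\<in>C - {c}. u a * inner a c)"
        using C(1) c by (rule sum.remove)
      also have "(\<Sum>a\<in>C - {c}. u a * inner a c) = 0"
        using C(3) c by (intro sum.neutral) (auto simp: pairwise_def Linear_Algebra.orthogonal_def)
      finally have "\<bar>u c\<bar> * (norm c * norm c) = \<bar>inner g c\<bar>"
        by (simp add: abs_mult power2_norm_eq_inner[symmetric] power2_eq_square)
      also have "\<dots> \<le> norm g * norm c" by (rule Cauchy_Schwarz_ineq2)
      finally show ?thesis by (cases "norm c = 0") (auto simp: mult.assoc[symmetric])
    qed
    have "norm (tail K g) \<le> (\<Sum>c\<in>C. norm (tail K (u c *\<^sub>R c)))"
      unfolding g linear_sum[OF linear_tail] by (rule norm_sum)
    also have "\<dots> \<le> (\<Sum>c\<in>C. \<delta> * norm g)"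
    proof (rule sum_mono)
      fix c assume c: "c \<in> C"
      have "norm (tail K (u c *\<^sub>R c)) = \<bar>u c\<bar> * norm (tail K c)"
        by (simp add: linear_cmul[OF linear_tail])
      also have "\<dots> \<le> \<bar>u c\<bar> * (\<delta> * norm c)" using K[OF c] by (intro mult_left_mono) auto
      also have "\<dots> = \<delta> * (\<bar>u c\<bar> * norm c)" by simp
      also have "\<dots> \<le> \<delta> * norm g" using coord[OF c] \<delta>(1) by (intro mult_left_mono) auto
      finally show "norm (tail K (u c *\<^sub>R c)) \<le> \<delta> * norm g" .
    qed
    also have "\<dots> = real (card C) * \<delta> * norm g" by simp
    also have "\<dots> \<le> e * norm g" using \<delta>(2) by (intro mult_right_mono) auto
    finally show ?thesis .
  qed
  thus ?thesis by blast
qed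

text \<open>Membership of the rescaled series \<open>F(r z)\<close> in the Fock space.\<close>

definition decays :: "real \<Rightarrow> 'd fock \<Rightarrow> bool" where
  "decays r F \<longleftrightarrow> sq_summable (\<lambda>\<alpha>. of_real (r ^ length \<alpha>) * coeff F \<alpha>)"

text \<open>The squared norm of a tail of \<open>g\<close> is the sum of those of the next shorter tails of its backward
  shifts, which stay in the space. So every depth inherits the halving from depth zero.\<close>

lemma halving_tails:
  fixes W :: "'d::finite fock set"
  assumes inv: "\<And>k g. g \<in> W \<Longrightarrow> bshift k g \<in> W"
    and half: "\<And>g. g \<in> W \<Longrightarrow> (norm (tail K g))\<^sup>2 \<le> (norm g)\<^sup>2 / 2"
  shows "g \<in> W \<Longrightarrow> (norm (tail (m + K) g))\<^sup>2 \<le> (norm (tail m g))\<^sup>2 / 2"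
proof (induction m arbitrary: g)
  case 0
  then show ?case using half by simp
next
  case (Suc m)
  have "(norm (tail (Suc m + K) g))\<^sup>2 = (\<Sum>k\<in>UNIV. (norm (tail (m + K) (bshift k g)))\<^sup>2)"
    using tail_Suc[of "m + K" g] by simp
  also have "\<dots> \<le> (\<Sum>k\<in>UNIV. (norm (tail m (bshift k g)))\<^sup>2 / 2)"
    by (intro sum_mono Suc.IH inv Suc.prems)
  also have "\<dots> = (norm (tail (Suc m) g))\<^sup>2 / 2"
    by (simp add: tail_Suc sum_divide_distrib)
  finally show ?case .
qed

lemma halving_tails_decay:
  assumes half: "\<And>m. (norm (tail (m + K) g))\<^sup>2 \<le> (norm (tail m g))\<^sup>2 / 2" and "K > 0"
  shows "\<exists>r>1. decays r g"
proof -
  have block: "(norm (tail (j * K) g))\<^sup>2 \<le> (norm g)\<^sup>2 * (1/2) ^ j" for j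
  proof (induction j)
    case (Suc j)
    thus ?case using half[of "j * K"] by (simp add: add.commute)
  qed simp
  \<comment> \<open>On the words with lengths in \<open>[jK, (j+1)K)\<close> the squared weights are at most \<open>(3/2)\<^sup>j\<^sup>+\<^sup>1\<close>, while the
    squared norms are at most \<open>2\<^sup>-\<^sup>j\<close>; the products form a geometric series with ratio \<open>3/4\<close>.\<close>
  define r where "r = root (2 * K) (3/2 :: real)"
  have r: "r > 1" "r ^ (2 * K) = 3/2"
    using \<open>K > 0\<close> by (auto simp: r_def real_root_gt_1_iff)
  let ?a = "\<lambda>\<alpha>. (cmod (of_real (r ^ length \<alpha>) * coeff g \<alpha>))\<^sup>2"
  have "sum ?a F \<le> 6 * (norm g)\<^sup>2" if F: "finite F" for F
  proof -
    let ?J = "(\<lambda>\<alpha>. length \<alpha> div K) ` F"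
    have blk: "(\<Sum>\<alpha>\<in>{\<alpha>\<in>F. length \<alpha> div K = j}. ?a \<alpha>) \<le> 3/2 * (norm g)\<^sup>2 * (3/4) ^ j" for j
    proof -
      let ?B = "{\<alpha>\<in>F. length \<alpha> div K = j}"
      have "?a \<alpha> \<le> (3/2) ^ Suc j * (cmod (coeff (tail (j * K) g) \<alpha>))\<^sup>2" if "\<alpha> \<in> ?B" for \<alpha>
      proof -
        have j: "length \<alpha> div K = j" using that by simp
        have 1: "j * K \<le> length \<alpha>" using j by (metis div_times_less_eq_dividend)
        have 2: "length \<alpha> \<le> Suc j * K"
          using j dividend_less_div_times[OF \<open>K > 0\<close>, of "length \<alpha>"] by simp
        have "(r ^ length \<alpha>)\<^sup>2 = r ^ (2 * length \<alpha>)" by (simp add: power_mult[symmetric] mult.commute)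
        also have "\<dots> \<le> r ^ (2 * K * Suc j)"
          using r(1) mult_le_mono2[OF 2, of 2] by (intro power_increasing) (simp_all only: mult_ac less_imp_le)
        also have "\<dots> = (3/2) ^ Suc j" unfolding power_mult[of r "2 * K"] r(2) ..
        finally have "(r ^ length \<alpha>)\<^sup>2 \<le> (3/2) ^ Suc j" .
        hence "(r ^ length \<alpha>)\<^sup>2 * (cmod (coeff g \<alpha>))\<^sup>2 \<le> (3/2) ^ Suc j * (cmod (coeff g \<alpha>))\<^sup>2"
          by (intro mult_right_mono) auto
        moreover have "?a \<alpha> = (r ^ length \<alpha>)\<^sup>2 * (cmod (coeff g \<alpha>))\<^sup>2"
          unfolding norm_mult norm_of_real power_mult_distrib power2_abs ..
        ultimately show ?thesis using 1 by (simp only: coeff_tail if_True)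
      qed
      hence "sum ?a ?B \<le> (\<Sum>\<alpha>\<in>?B. (3/2) ^ Suc j * (cmod (coeff (tail (j * K) g) \<alpha>))\<^sup>2)"
        by (intro sum_mono)
      also have "\<dots> = (3/2) ^ Suc j * (\<Sum>\<alpha>\<in>?B. (cmod (coeff (tail (j * K) g) \<alpha>))\<^sup>2)"
        by (simp only: sum_distrib_left)
      also have "\<dots> \<le> (3/2) ^ Suc j * (norm (tail (j * K) g))\<^sup>2"
        using F by (intro mult_left_mono sum_coeff_le_norm) auto
      also have "\<dots> \<le> (3/2) ^ Suc j * ((norm g)\<^sup>2 * (1/2) ^ j)"
        by (intro mult_left_mono block) auto
      also have "\<dots> = 3/2 * (norm g)\<^sup>2 * ((3/2) * (1/2)) ^ j"
        by (simp only: power_Suc power_mult_distrib mult_ac)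
      finally show ?thesis by simp
    qed
    have "sum ?a F = (\<Sum>j\<in>?J. \<Sum>\<alpha>\<in>{\<alpha>\<in>F. length \<alpha> div K = j}. ?a \<alpha>)"
      by (rule sum.group[symmetric]) (use F in auto)
    also have "\<dots> \<le> (\<Sum>j\<in>?J. 3/2 * (norm g)\<^sup>2 * (3/4) ^ j)" by (intro sum_mono blk)
    also have "\<dots> = 3/2 * (norm g)\<^sup>2 * (\<Sum>j\<in>?J. (3/4) ^ j)" by (simp add: sum_distrib_left)
    also have "\<dots> \<le> 3/2 * (norm g)\<^sup>2 * (\<Sum>j. (3/4) ^ j)"
      using F by (intro mult_left_mono sum_le_suminf) (auto simp: summable_geometric)
    also have "(\<Sum>j. (3/4::real) ^ j) = 4" by (subst suminf_geometric) auto
    finally show ?thesis by simp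
  qed
  hence "decays r g" unfolding decays_def by (rule sq_summable_bounded)
  thus ?thesis using r(1) by blast
qed

text \<open>Let \<open>F q\<close> be a polynomial. All iterated backward shifts \<open>g\<close> of \<open>F\<close> satisfy that \<open>g q\<close> is a
  polynomial of bounded degree, by the product rule; as \<open>q\<close> is not a zero divisor, they span a space of
  finite dimension. So a square-summable rational series is regular on a row ball of radius larger
  than one.\<close>

lemma rational_decays:
  fixes F :: "'d::finite fock"
  assumes q: "nc_polynomial q" "coeff q [] \<noteq> 0" and p: "nc_polynomial (rmul q F)"
  shows "\<exists>r>1. decays r F"
proof -
  define N where "N = max (nc_degree q) (nc_degree (rmul q F))"
  define W where "W = {g. \<forall>\<alpha>. length \<alpha> > N \<longrightarrow> coeff (rmul q g) \<alpha> = 0}"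
  have FW: "F \<in> W" using nc_degree_less[OF p] by (auto simp: W_def N_def)
  have inv: "bshift k g \<in> W" if "g \<in> W" for k g
    using that nc_degree_less[OF q(1)] by (auto simp: W_def N_def bshift_rmul[OF q(1)])
  obtain B where B: "B \<subseteq> W" "independent B" "W \<subseteq> span B" by (rule basis_exists)
  have inj: "inj_on (rmul q) A" for A
    using linear_injective_0[OF linear_rmul] rmul_eq_0[OF q] by (blast intro: inj_on_subset)
  \<comment> \<open>The spans here are real, so every monomial has to contribute two directions.\<close>
  define E :: "'d fock set" where
    "E = (\<lambda>(c, \<alpha>). cscale c (unit \<alpha>)) ` ({1, \<i>} \<times> {\<alpha>. length \<alpha> \<le> N})"
  have finN: "finite {\<alpha> :: 'd list. length \<alpha> \<le> N}"
    using finite_lists_length_le[of "UNIV :: 'd set" N] by simp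
  have finE: "finite E" unfolding E_def using finN by simp
  have "rmul q g \<in> span E" if "g \<in> W" for g
  proof -
    let ?x = "rmul q g"
    have "?x = restr {\<alpha>. length \<alpha> \<le> N} ?x"
      using that by (intro ell2_eqI) (simp add: coeff_restr W_def)
    also have "\<dots> = (\<Sum>\<alpha>\<in>{\<alpha>. length \<alpha> \<le> N}. Re (coeff ?x \<alpha>) *\<^sub>R cscale 1 (unit \<alpha>)
        + Im (coeff ?x \<alpha>) *\<^sub>R cscale \<i> (unit \<alpha>))"
      unfolding restr_finite[OF finN]
      by (intro sum.cong refl ell2_eqI) (simp add: coeff_unit complex_eq mult.commute)
    also have "\<dots> \<in> span E"
      by (intro span_sum span_add span_scale span_base) (auto simp: E_def image_iff)
    finally show ?thesis .
  qed
  hence "rmul q ` B \<subseteq> span E" using B(1) by blast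
  moreover have "independent (rmul q ` B)"
    by (rule linear_independent_injective_image[OF linear_rmul B(2) inj])
  ultimately have "finite (rmul q ` B)" using independent_span_bound[OF finE] by blast
  hence "finite B" by (rule finite_imageD[OF _ inj])
  then obtain K where K: "\<forall>g\<in>span B. norm (tail K g) \<le> (1/2) * norm g"
    using tail_uniformly_small[of B "1/2"] by auto
  have "(norm (tail (Suc K) g))\<^sup>2 \<le> (norm g)\<^sup>2 / 2" if "g \<in> W" for g
  proof -
    have "norm (tail (Suc K) g) \<le> (1/2) * norm g"
      using K that B(3) norm_tail_antimono[of K "Suc K" g] by force
    hence "(norm (tail (Suc K) g))\<^sup>2 \<le> ((1/2) * norm g)\<^sup>2" by (intro power_mono) auto
    also have "\<dots> \<le> (norm g)\<^sup>2 / 2" by (simp add: power2_eq_square)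
    finally show ?thesis .
  qed
  from halving_tails[OF inv this FW] show ?thesis
    by (intro halving_tails_decay[of "Suc K"]) auto
qed

lemma decays_add: "decays r F \<Longrightarrow> decays r G \<Longrightarrow> decays r (F + G)"
  unfolding decays_def by (drule (1) sq_summable_add) (simp add: distrib_left)

lemma decays_cscale: "decays r F \<Longrightarrow> decays r (cscale c F)"
  unfolding decays_def by (drule sq_summable_mult[of _ c]) (simp add: mult_ac)

lemma decays_zero: "decays r 0"
  by (simp add: decays_def sq_summable_0)

lemma decays_sum: "(\<And>a. a \<in> A \<Longrightarrow> decays r (F a)) \<Longrightarrow> decays r (\<Sum>a\<in>A. F a)"
  by (induction A rule: infinite_finite_induct) (auto intro: decays_add decays_zero)

lemma decays_diff: "decays r F \<Longrightarrow> decays r G \<Longrightarrow> decays r (F - G)"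
  using sq_summable_add[OF _ sq_summable_mult[of _ "-1"]]
  unfolding decays_def by (fastforce simp: algebra_simps)

lemma decays_rmon:
  assumes "decays r F"
  shows "decays r (rmon \<beta> F)"
proof -
  let ?G = "Abs_ell2 (\<lambda>\<alpha>. of_real (r ^ length \<alpha>) * coeff F \<alpha>)"
  have "coeff (cscale (of_real (r ^ length \<beta>)) (rmon \<beta> ?G)) \<gamma>
      = of_real (r ^ length \<gamma>) * coeff (rmon \<beta> F) \<gamma>" for \<gamma>
    by (rule rmon_cases[of \<gamma> \<beta>])
      (use assms in \<open>auto simp: decays_def coeff_Abs power_add mult_ac\<close>)
  hence "(\<lambda>\<gamma>. of_real (r ^ length \<gamma>) * coeff (rmon \<beta> F) \<gamma>)
      = coeff (cscale (of_real (r ^ length \<beta>)) (rmon \<beta> ?G))"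
    by (intro ext) (rule sym)
  thus ?thesis unfolding decays_def using sq_summable_coeff by metis
qed

lemma decays_unit: "decays r (unit \<beta>)"
proof -
  have "(\<lambda>\<alpha>. of_real (r ^ length \<alpha>) * coeff (unit \<beta>) \<alpha>)
      = coeff (cscale (of_real (r ^ length \<beta>)) (unit \<beta>))"
    by (auto simp: coeff_unit)
  thus ?thesis unfolding decays_def using sq_summable_coeff by metis
qed

lemma decays_polynomial: "nc_polynomial x \<Longrightarrow> decays r x"
  unfolding nc_polynomial_def
  by (subst finite_support_expand) (auto intro: decays_sum decays_cscale decays_unit)

lemma decays_rmul: "decays r F \<Longrightarrow> decays r (rmul q F)"
  unfolding rmul_def by (intro decays_sum decays_cscale decays_rmon)

lemma (in isometric_multiplier) T_rmul: "nc_polynomial q \<Longrightarrow> blinfun_apply T q = rmul q \<Theta>"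
  unfolding nc_polynomial_def by (simp add: T_finite_support rmul_def)

section \<open>Evaluation functionals\<close>

lemma finite_words_length: "finite {\<alpha> :: 'd::finite list. length \<alpha> = k}"
  using finite_lists_length_eq[of "UNIV :: 'd set" k] by simp

lemma sum_words_Suc:
  "(\<Sum>\<alpha> | length \<alpha> = Suc k. f \<alpha>) = (\<Sum>j\<in>(UNIV :: 'd::finite set). \<Sum>\<alpha> | length \<alpha> = k. f (j # \<alpha>))"
proof -
  have "{\<alpha> :: 'd list. length \<alpha> = Suc k} = (\<lambda>(j, \<alpha>). j # \<alpha>) ` (UNIV \<times> {\<alpha>. length \<alpha> = k})"
    by (auto simp: length_Suc_conv image_iff)
  moreover have "inj_on (\<lambda>(j, \<alpha>). j # \<alpha>) (UNIV \<times> {\<alpha> :: 'd list. length \<alpha> = k})"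
    by (auto simp: inj_on_def)
  ultimately have "(\<Sum>\<alpha> | length \<alpha> = Suc k. f \<alpha>)
      = (\<Sum>(j, \<alpha>)\<in>UNIV \<times> {\<alpha> :: 'd list. length \<alpha> = k}. f (j # \<alpha>))"
    by (simp add: sum.reindex o_def case_prod_unfold)
  thus ?thesis by (simp add: sum.cartesian_product)
qed

lemma sq_summable_geometric:
  fixes c :: "'d::finite list \<Rightarrow> complex"
  assumes bound: "\<And>k. (\<Sum>\<alpha> | length \<alpha> = k. (cmod (c \<alpha>))\<^sup>2) \<le> C * \<rho> ^ k" and \<rho>: "0 \<le> \<rho>" "\<rho> < 1" and "C \<ge> 0"
  shows "sq_summable c"
proof (rule sq_summable_bounded)
  fix F :: "'d list set" assume F: "finite F"
  have "(\<Sum>\<alpha>\<in>F. (cmod (c \<alpha>))\<^sup>2) = (\<Sum>k\<in>length ` F. \<Sum>\<alpha>\<in>{\<alpha>\<in>F. length \<alpha> = k}. (cmod (c \<alpha>))\<^sup>2)"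
    by (rule sum.group[symmetric]) (use F in auto)
  also have "\<dots> \<le> (\<Sum>k\<in>length ` F. C * \<rho> ^ k)"
  proof (rule sum_mono)
    fix k
    have "(\<Sum>\<alpha>\<in>{\<alpha>\<in>F. length \<alpha> = k}. (cmod (c \<alpha>))\<^sup>2) \<le> (\<Sum>\<alpha> | length \<alpha> = k. (cmod (c \<alpha>))\<^sup>2)"
      by (rule sum_mono2) (auto simp: finite_words_length)
    thus "(\<Sum>\<alpha>\<in>{\<alpha>\<in>F. length \<alpha> = k}. (cmod (c \<alpha>))\<^sup>2) \<le> C * \<rho> ^ k" using bound[of k] by simp
  qed
  also have "\<dots> \<le> (\<Sum>k. C * \<rho> ^ k)"
    using F assms(2-) by (intro sum_le_suminf) (auto intro!: summable_mult summable_geometric)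
  finally show "(\<Sum>\<alpha>\<in>F. (cmod (c \<alpha>))\<^sup>2) \<le> (\<Sum>k. C * \<rho> ^ k)" .
qed

text \<open>The partial sums are inner products with the truncations \<open>F - tail n F\<close>, which converge to \<open>F\<close> in
  norm.\<close>

lemma cinner_sums_by_length:
  fixes F :: "'d::finite fock"
  shows "(\<lambda>k. \<Sum>\<alpha> | length \<alpha> = k. cnj (coeff x \<alpha>) * coeff F \<alpha>) sums cinner x F"
proof -
  have lt: "finite {\<alpha> :: 'd list. length \<alpha> < n}" for n
    using finite_lists_length_le[of "UNIV :: 'd set" n] by (rule rev_finite_subset) auto
  have part: "(\<Sum>k<n. \<Sum>\<alpha> | length \<alpha> = k. cnj (coeff x \<alpha>) * coeff F \<alpha>) = cinner x (F - tail n F)" for n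
  proof -
    have "F - tail n F = restr {\<alpha>. length \<alpha> < n} F"
      by (rule ell2_eqI) (auto simp: coeff_tail coeff_restr)
    also have "cinner x \<dots> = (\<Sum>\<alpha> | length \<alpha> < n. cnj (coeff x \<alpha>) * coeff F \<alpha>)"
      unfolding restr_finite[OF lt] cinner_sum_right cinner_cscale_right
      by (intro sum.cong refl, subst cinner_commute) (simp add: cinner_unit_left mult.commute)
    also have "\<dots> = (\<Sum>k<n. \<Sum>\<alpha>\<in>{\<alpha>\<in>{\<alpha>. length \<alpha> < n}. length \<alpha> = k}. cnj (coeff x \<alpha>) * coeff F \<alpha>)"
      by (rule sum.group[symmetric]) (use lt in auto)
    also have "\<dots> = (\<Sum>k<n. \<Sum>\<alpha> | length \<alpha> = k. cnj (coeff x \<alpha>) * coeff F \<alpha>)"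
      by (intro sum.cong) auto
    finally show ?thesis by simp
  qed
  have "(\<lambda>n. tail n F) \<longlonglongrightarrow> 0"
    by (rule LIMSEQ_I) (use tail_eventually_small in auto)
  hence "(\<lambda>n. cinner x (F - tail n F)) \<longlonglongrightarrow> cinner x (F - 0)"
    by (intro tendsto_cinner_right tendsto_intros)
  thus ?thesis by (simp add: sums_def part)
qed

subsection \<open>Matrix points\<close>

text \<open>A row vector \<open>w\<close> is represented by its entries, indexed below \<open>n\<close>.\<close>

definition row_mult :: "nat \<Rightarrow> (nat \<Rightarrow> complex) \<Rightarrow> complex mat \<Rightarrow> nat \<Rightarrow> complex" where
  "row_mult n w A b = (\<Sum>a<n. w a * A $$ (a, b))"

definition row_sq :: "nat \<Rightarrow> (nat \<Rightarrow> complex) \<Rightarrow> real" where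
  "row_sq n w = (\<Sum>b<n. (cmod (w b))\<^sup>2)"

lemma mult_mat_entry:
  assumes "A \<in> carrier_mat n n" "B \<in> carrier_mat n n" "a < n" "b < n"
  shows "(A * B) $$ (a, b) = (\<Sum>c<n. A $$ (a, c) * B $$ (c, b))"
  using assms by (auto simp: scalar_prod_def atLeast0LessThan)

lemma mat_word_carrier: "X \<in> mat_tuples n \<Longrightarrow> mat_word n X \<alpha> \<in> carrier_mat n n"
  by (induction \<alpha>) (auto simp: mat_tuples_def intro: mult_carrier_mat)

lemma mat_word_append:
  assumes "X \<in> mat_tuples n"
  shows "mat_word n X (\<alpha> @ \<beta>) = mat_word n X \<alpha> * mat_word n X \<beta>"
proof (induction \<alpha>)
  case Nil
  show ?case using mat_word_carrier[OF assms, of \<beta>] by simp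
next
  case (Cons k \<alpha>)
  have "X k \<in> carrier_mat n n" using assms by (auto simp: mat_tuples_def)
  thus ?case using Cons mat_word_carrier[OF assms, of \<alpha>] mat_word_carrier[OF assms, of \<beta>]
    by (simp add: assoc_mult_mat[of _ n n _ n _ n])
qed

lemma row_mult_mult:
  assumes "A \<in> carrier_mat n n" "B \<in> carrier_mat n n" "b < n"
  shows "row_mult n w (A * B) b = row_mult n (row_mult n w A) B b"
proof -
  have "row_mult n w (A * B) b = (\<Sum>a<n. \<Sum>c<n. w a * A $$ (a, c) * B $$ (c, b))"
    using assms by (simp add: row_mult_def mult_mat_entry sum_distrib_left mult.assoc del: index_mult_mat)
  also have "\<dots> = (\<Sum>c<n. \<Sum>a<n. w a * A $$ (a, c) * B $$ (c, b))" by (rule sum.swap)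
  finally show ?thesis by (simp add: row_mult_def sum_distrib_right)
qed

lemma vec_norm2_L2_set:
  assumes "v \<in> carrier_vec n"
  shows "vec_norm2 v = L2_set (\<lambda>i. cmod (vec_index v i)) {..<n}"
proof -
  have "Re (v \<bullet>c v) = (\<Sum>i<n. (cmod (vec_index v i))\<^sup>2)"
    using assms
    by (simp add: scalar_prod_def atLeast0LessThan conjugate_complex_def flip: complex_norm_square)
  thus ?thesis by (simp add: vec_norm2_def L2_set_def)
qed

lemma vec_norm2_smult:
  assumes "v \<in> carrier_vec n"
  shows "vec_norm2 (c \<cdot>\<^sub>v v) = cmod c * vec_norm2 v"
  using assms vec_norm2_L2_set[of "c \<cdot>\<^sub>v v" n] vec_norm2_L2_set[OF assms]
    L2_set_right_distrib[of "cmod c" "\<lambda>i. cmod (vec_index v i)" "{..<n}"]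
  by (simp add: norm_mult L2_set_def)

text \<open>The supremum defining the norm is of use only once the set is known to be bounded; the sum of the
  absolute values of all entries bounds it.\<close>

lemma mat_norm_bound:
  assumes A: "A \<in> carrier_mat n n" and v: "v \<in> carrier_vec n"
  shows "vec_norm2 (A *\<^sub>v v) \<le> mat_norm n A * vec_norm2 v"
proof -
  let ?S = "{v \<in> carrier_vec n. vec_norm2 v \<le> 1}"
  have "vec_norm2 (A *\<^sub>v v) \<le> (\<Sum>i<n. \<Sum>j<n. cmod (A $$ (i, j)))" if "v \<in> ?S" for v
  proof -
    have v: "v \<in> carrier_vec n" using that by simp
    have Av: "A *\<^sub>v v \<in> carrier_vec n" using A v by simp
    have le1: "cmod (vec_index v j) \<le> 1" if "j < n" for j
      using member_le_L2_set[of "{..<n}" j "\<lambda>i. cmod (vec_index v i)"] that \<open>v \<in> ?S\<close>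
      by (simp add: vec_norm2_L2_set[OF v])
    have "vec_norm2 (A *\<^sub>v v) \<le> (\<Sum>i<n. cmod (vec_index (A *\<^sub>v v) i))"
      unfolding vec_norm2_L2_set[OF Av] by (rule L2_set_le_sum) simp
    also have "\<dots> \<le> (\<Sum>i<n. \<Sum>j<n. cmod (A $$ (i, j)))"
    proof (rule sum_mono)
      fix i assume i: "i \<in> {..<n}"
      have "vec_index (A *\<^sub>v v) i = (\<Sum>j<n. A $$ (i, j) * vec_index v j)"
        using A v i by (simp add: scalar_prod_def atLeast0LessThan)
      hence "cmod (vec_index (A *\<^sub>v v) i) \<le> (\<Sum>j<n. cmod (A $$ (i, j) * vec_index v j))"
        by (simp add: norm_sum)
      also have "\<dots> \<le> (\<Sum>j<n. cmod (A $$ (i, j)))"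
        using le1 by (intro sum_mono) (simp add: norm_mult mult_left_le)
      finally show "cmod (vec_index (A *\<^sub>v v) i) \<le> (\<Sum>j<n. cmod (A $$ (i, j)))" .
    qed
    finally show ?thesis .
  qed
  hence bdd: "bdd_above ((\<lambda>v. vec_norm2 (A *\<^sub>v v)) ` ?S)" by (rule bdd_aboveI2)
  show ?thesis
  proof (cases "vec_norm2 v = 0")
    case True
    hence "vec_index v i = 0" if "i < n" for i
      using that by (simp add: vec_norm2_L2_set[OF v] L2_set_eq_0_iff)
    hence "v = 0\<^sub>v n" using v by (intro eq_vecI) auto
    hence "A *\<^sub>v v = 0\<^sub>v n" using A by (intro eq_vecI) (auto simp: scalar_prod_def)
    hence "vec_norm2 (A *\<^sub>v v) = 0" by (simp add: vec_norm2_L2_set[of _ n] L2_set_eq_0_iff)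
    thus ?thesis using True by simp
  next
    case False
    hence pos: "vec_norm2 v > 0" by (simp add: vec_norm2_L2_set[OF v] less_le)
    let ?c = "complex_of_real (1 / vec_norm2 v)"
    have "vec_norm2 (?c \<cdot>\<^sub>v v) = 1"
      unfolding vec_norm2_smult[OF v] norm_of_real using pos by simp
    hence "vec_norm2 (A *\<^sub>v (?c \<cdot>\<^sub>v v)) \<le> mat_norm n A"
      unfolding mat_norm_def using v by (intro cSUP_upper bdd) auto
    moreover have "A *\<^sub>v (?c \<cdot>\<^sub>v v) = ?c \<cdot>\<^sub>v (A *\<^sub>v v)"
      using A v by (rule mult_mat_vec)
    moreover have "vec_norm2 (?c \<cdot>\<^sub>v (A *\<^sub>v v)) = vec_norm2 (A *\<^sub>v v) / vec_norm2 v"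
      using vec_norm2_smult[of "A *\<^sub>v v" n ?c] A v pos unfolding norm_of_real by simp
    ultimately have "vec_norm2 (A *\<^sub>v v) / vec_norm2 v \<le> mat_norm n A" by (simp only:)
    thus ?thesis using pos by (simp add: pos_divide_le_eq)
  qed
qed

lemma row_gram_entry:
  assumes "X \<in> mat_tuples n" "a < n" "a' < n"
  shows "row_gram n X $$ (a, a') = (\<Sum>j\<in>UNIV. \<Sum>b<n. X j $$ (a, b) * cnj (X j $$ (a', b)))"
proof -
  have "(X j * mat_adjoint (X j)) $$ (a, a') = (\<Sum>b<n. X j $$ (a, b) * cnj (X j $$ (a', b)))" for j
  proof -
    have X: "X j \<in> carrier_mat n n" using assms(1) by (auto simp: mat_tuples_def)
    have adj: "mat_adjoint (X j) \<in> carrier_mat n n" using X by (intro carrier_matI) (auto simp: mat_adjoint_def)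
    have "mat_adjoint (X j) $$ (b, a') = cnj (X j $$ (a', b))" if "b < n" for b
      using X assms(3) that by (simp add: mat_adjoint_def mat_of_rows_index conjugate_complex_def)
    thus ?thesis unfolding mult_mat_entry[OF X adj assms(2,3)] by (intro sum.cong) auto
  qed
  thus ?thesis using assms by (simp add: row_gram_def)
qed

text \<open>As \<open>\<Sum>\<^sub>j \<parallel>w X\<^sub>j\<parallel>\<^sup>2 = w G w\<^sup>*\<close> with \<open>G = \<Sum>\<^sub>j X\<^sub>j X\<^sub>j\<^sup>*\<close>, this is the Cauchy-Schwarz inequality.\<close>

lemma row_contraction:
  assumes X: "X \<in> mat_tuples n"
  shows "(\<Sum>j\<in>UNIV. row_sq n (row_mult n w (X j))) \<le> mat_norm n (row_gram n X) * row_sq n w"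
proof -
  let ?G = "row_gram n X"
  let ?v = "Matrix.vec n (\<lambda>i. cnj (w i))"
  have G: "?G \<in> carrier_mat n n" by (simp add: row_gram_def)
  have v: "?v \<in> carrier_vec n" by simp
  have Gv: "?G *\<^sub>v ?v \<in> carrier_vec n" using G v by simp
  have nv: "vec_norm2 ?v = sqrt (row_sq n w)"
    by (simp add: vec_norm2_L2_set[OF v] L2_set_def row_sq_def)
  have pos: "row_sq n w \<ge> 0" by (simp add: row_sq_def sum_nonneg)
  have "of_real (\<Sum>j\<in>UNIV. row_sq n (row_mult n w (X j)))
      = (\<Sum>j\<in>UNIV. \<Sum>b<n. row_mult n w (X j) b * cnj (row_mult n w (X j) b))"
    unfolding row_sq_def of_real_sum complex_norm_square ..
  also have "\<dots> = (\<Sum>j\<in>UNIV. \<Sum>b<n. \<Sum>a<n. \<Sum>a'<n. w a * cnj (w a') * (X j $$ (a, b) * cnj (X j $$ (a', b))))"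
    by (simp add: row_mult_def sum_product mult_ac)
  also have "\<dots> = (\<Sum>j\<in>UNIV. \<Sum>a<n. \<Sum>a'<n. \<Sum>b<n. w a * cnj (w a') * (X j $$ (a, b) * cnj (X j $$ (a', b))))"
    by (rule sum.cong[OF refl], rule trans[OF sum.swap], rule sum.cong[OF refl], rule sum.swap)
  also have "\<dots> = (\<Sum>a<n. \<Sum>a'<n. \<Sum>j\<in>UNIV. \<Sum>b<n. w a * cnj (w a') * (X j $$ (a, b) * cnj (X j $$ (a', b))))"
    by (rule trans[OF sum.swap], rule sum.cong[OF refl], rule sum.swap)
  also have "\<dots> = (\<Sum>a<n. w a * (\<Sum>a'<n. ?G $$ (a, a') * cnj (w a')))"
    by (simp add: row_gram_entry[OF X] sum_distrib_left mult_ac)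
  also have "\<dots> = (\<Sum>a<n. w a * vec_index (?G *\<^sub>v ?v) a)"
    using G by (intro sum.cong refl) (simp add: scalar_prod_def atLeast0LessThan)
  finally have "\<bar>\<Sum>j\<in>UNIV. row_sq n (row_mult n w (X j))\<bar> = cmod (\<Sum>a<n. w a * vec_index (?G *\<^sub>v ?v) a)"
    by (metis norm_of_real)
  hence "(\<Sum>j\<in>UNIV. row_sq n (row_mult n w (X j))) \<le> cmod (\<Sum>a<n. w a * vec_index (?G *\<^sub>v ?v) a)"
    by linarith
  also have "\<dots> \<le> (\<Sum>a<n. \<bar>cmod (w a)\<bar> * \<bar>cmod (vec_index (?G *\<^sub>v ?v) a)\<bar>)"
    by (rule order_trans[OF norm_sum]) (simp add: norm_mult)
  also have "\<dots> \<le> L2_set (\<lambda>a. cmod (w a)) {..<n} * L2_set (\<lambda>a. cmod (vec_index (?G *\<^sub>v ?v) a)) {..<n}"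
    by (rule L2_set_mult_ineq)
  also have "\<dots> = sqrt (row_sq n w) * vec_norm2 (?G *\<^sub>v ?v)"
    by (simp add: vec_norm2_L2_set[OF Gv] L2_set_def row_sq_def)
  also have "\<dots> \<le> sqrt (row_sq n w) * (mat_norm n ?G * sqrt (row_sq n w))"
    using mat_norm_bound[OF G v] pos by (intro mult_left_mono) (auto simp: nv)
  also have "\<dots> = mat_norm n ?G * row_sq n w" using pos by simp
  finally show ?thesis .
qed

text \<open>Splitting off the first letter \<open>j\<close> of a word turns the row vector \<open>w\<close> into \<open>w X\<^sub>j\<close>, so the one-letter
  estimate can be iterated.\<close>

lemma row_power_contraction:
  assumes X: "X \<in> mat_tuples n" and \<rho>: "mat_norm n (row_gram n X) \<le> \<rho>" "0 \<le> \<rho>"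
  shows "(\<Sum>\<alpha> | length \<alpha> = k. row_sq n (row_mult n w (mat_word n X \<alpha>))) \<le> row_sq n w * \<rho> ^ k"
proof (induction k arbitrary: w)
  case 0
  have "row_mult n w (1\<^sub>m n) b = w b" if "b < n" for b
    using that by (simp add: row_mult_def if_distrib sum.delta cong: if_cong)
  thus ?case by (simp add: row_sq_def)
next
  case (Suc k)
  have "row_mult n w (mat_word n X (j # \<alpha>)) b = row_mult n (row_mult n w (X j)) (mat_word n X \<alpha>) b"
    if "b < n" for j \<alpha> b
    using X mat_word_carrier[OF X, of \<alpha>] that row_mult_mult[of "X j" n "mat_word n X \<alpha>" b w]
    by (auto simp: mat_tuples_def)
  hence eq: "row_sq n (row_mult n w (mat_word n X (j # \<alpha>)))
      = row_sq n (row_mult n (row_mult n w (X j)) (mat_word n X \<alpha>))" for j \<alpha>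
    unfolding row_sq_def by (intro sum.cong) auto
  have "(\<Sum>\<alpha> | length \<alpha> = Suc k. row_sq n (row_mult n w (mat_word n X \<alpha>)))
      = (\<Sum>j\<in>UNIV. \<Sum>\<alpha> | length \<alpha> = k. row_sq n (row_mult n (row_mult n w (X j)) (mat_word n X \<alpha>)))"
    unfolding sum_words_Suc eq ..
  also have "\<dots> \<le> (\<Sum>j\<in>UNIV. row_sq n (row_mult n w (X j)) * \<rho> ^ k)"
    by (intro sum_mono Suc.IH)
  also have "\<dots> = (\<Sum>j\<in>UNIV. row_sq n (row_mult n w (X j))) * \<rho> ^ k"
    by (simp add: sum_distrib_right)
  also have "\<dots> \<le> (\<rho> * row_sq n w) * \<rho> ^ k"
  proof (rule mult_right_mono)
    have "mat_norm n (row_gram n X) * row_sq n w \<le> \<rho> * row_sq n w"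
      using \<rho> by (intro mult_right_mono) (auto simp: row_sq_def sum_nonneg)
    thus "(\<Sum>j\<in>UNIV. row_sq n (row_mult n w (X j))) \<le> \<rho> * row_sq n w"
      using row_contraction[OF X, of w] by linarith
  qed (use \<rho> in simp)
  finally show ?case by (simp add: mult_ac)
qed

lemma row_ball_sq_summable:
  assumes X: "X \<in> row_ball n" and b: "b < n"
  shows "sq_summable (\<lambda>\<alpha>. cnj (row_mult n w (mat_word n X \<alpha>) b))"
proof (rule sq_summable_geometric)
  let ?\<rho> = "max 0 (mat_norm n (row_gram n X))"
  show "0 \<le> ?\<rho>" "?\<rho> < 1" using X by (auto simp: row_ball_def)
  show "0 \<le> row_sq n w" by (simp add: row_sq_def sum_nonneg)
  fix k
  have "(\<Sum>\<alpha> | length \<alpha> = k. (cmod (cnj (row_mult n w (mat_word n X \<alpha>) b)))\<^sup>2)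
      \<le> (\<Sum>\<alpha> | length \<alpha> = k. row_sq n (row_mult n w (mat_word n X \<alpha>)))"
    unfolding row_sq_def using b by (intro sum_mono) (auto intro!: member_le_sum)
  also have "\<dots> \<le> row_sq n w * ?\<rho> ^ k"
    by (rule row_power_contraction) (use X in \<open>auto simp: row_ball_def\<close>)
  finally show "(\<Sum>\<alpha> | length \<alpha> = k. (cmod (cnj (row_mult n w (mat_word n X \<alpha>) b)))\<^sup>2) \<le> row_sq n w * ?\<rho> ^ k" .
qed

text \<open>The vector representing the functional \<open>F \<mapsto> (w F(X))\<^sub>b\<close>, an NC Szego kernel.\<close>

definition row_kernel :: "nat \<Rightarrow> ('d \<Rightarrow> complex mat) \<Rightarrow> (nat \<Rightarrow> complex) \<Rightarrow> nat \<Rightarrow> 'd fock" where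
  "row_kernel n X w b = Abs_ell2 (\<lambda>\<alpha>. cnj (row_mult n w (mat_word n X \<alpha>) b))"

lemma coeff_row_kernel:
  "X \<in> row_ball n \<Longrightarrow> b < n \<Longrightarrow> coeff (row_kernel n X w b) \<alpha> = cnj (row_mult n w (mat_word n X \<alpha>) b)"
  unfolding row_kernel_def by (rule coeff_Abs[OF row_ball_sq_summable])

text \<open>Unit row vectors \<open>w\<close> give the convergence of the single entries, after which the sum over the
  entries of a general \<open>w\<close> may be exchanged with the series.\<close>

lemma
  fixes F :: "'d::finite fock"
  assumes X: "X \<in> row_ball n" and b: "b < n"
  shows summable_mat_term: "a < n \<Longrightarrow> summable (\<lambda>k. mat_term n (coeff F) X k (a, b))"
    and cinner_row_kernel: "cinner (row_kernel n X w b) F = row_mult n w (mat_eval n (coeff F) X) b"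
proof -
  have sums: "(\<lambda>k. \<Sum>a<n. w a * mat_term n (coeff F) X k (a, b)) sums cinner (row_kernel n X w b) F" for w
  proof -
    have "(\<Sum>\<alpha> | length \<alpha> = k. cnj (coeff (row_kernel n X w b) \<alpha>) * coeff F \<alpha>)
        = (\<Sum>a<n. w a * mat_term n (coeff F) X k (a, b))" for k
    proof -
      have "(\<Sum>\<alpha> | length \<alpha> = k. cnj (coeff (row_kernel n X w b) \<alpha>) * coeff F \<alpha>)
          = (\<Sum>\<alpha> | length \<alpha> = k. \<Sum>a<n. w a * (coeff F \<alpha> * mat_word n X \<alpha> $$ (a, b)))"
        using X b by (simp add: coeff_row_kernel row_mult_def sum_distrib_left sum_distrib_right mult_ac)
      also have "\<dots> = (\<Sum>a<n. \<Sum>\<alpha> | length \<alpha> = k. w a * (coeff F \<alpha> * mat_word n X \<alpha> $$ (a, b)))"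
        by (rule sum.swap)
      finally show ?thesis by (simp add: mat_term_def sum_distrib_left)
    qed
    thus ?thesis using cinner_sums_by_length[of "row_kernel n X w b" F] by simp
  qed
  show summable: "summable (\<lambda>k. mat_term n (coeff F) X k (a, b))" if "a < n" for a
    using sums[of "\<lambda>i. if i = a then 1 else 0"] that
    by (auto simp: sums_iff if_distrib[of "\<lambda>x. x * _"] sum.delta cong: if_cong)
  have "(\<lambda>k. \<Sum>a<n. w a * mat_term n (coeff F) X k (a, b))
      sums (\<Sum>a<n. w a * (\<Sum>k. mat_term n (coeff F) X k (a, b)))"
    by (intro sums_sum sums_mult summable_sums summable) simp
  from sums_unique2[OF sums this]
  show "cinner (row_kernel n X w b) F = row_mult n w (mat_eval n (coeff F) X) b"
    using b by (simp add: row_mult_def mat_eval_def)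
qed

lemma row_kernel_rmon:
  fixes F :: "'d::finite fock"
  assumes X: "X \<in> row_ball n" and b: "b < n"
  shows "cinner (row_kernel n X w b) (rmon \<beta> F)
    = (\<Sum>c<n. cinner (row_kernel n X w c) F * mat_word n X \<beta> $$ (c, b))"
proof -
  have X': "X \<in> mat_tuples n" using X by (simp add: row_ball_def)
  have "cnj (coeff (row_kernel n X w b) (\<alpha> @ \<beta>))
      = (\<Sum>c<n. mat_word n X \<beta> $$ (c, b) * cnj (coeff (row_kernel n X w c) \<alpha>))" for \<alpha>
    using b by (simp add: coeff_row_kernel[OF X] mat_word_append[OF X']
        row_mult_mult[OF mat_word_carrier[OF X'] mat_word_carrier[OF X'] b])
      (simp add: row_mult_def[of n "row_mult n w _"] mult.commute)
  hence "cinner (row_kernel n X w b) (rmon \<beta> F)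
      = (\<Sum>\<^sub>\<infinity>\<alpha>. \<Sum>c<n. mat_word n X \<beta> $$ (c, b) * (cnj (coeff (row_kernel n X w c) \<alpha>) * coeff F \<alpha>))"
    by (simp add: cinner_rmon_expand sum_distrib_right mult.assoc)
  also have "\<dots> = (\<Sum>c<n. \<Sum>\<^sub>\<infinity>\<alpha>. mat_word n X \<beta> $$ (c, b) * (cnj (coeff (row_kernel n X w c) \<alpha>) * coeff F \<alpha>))"
    by (intro infsum_finite_sum summable_on_cmult_right summable_cinner)
  also have "\<dots> = (\<Sum>c<n. mat_word n X \<beta> $$ (c, b) * cinner (row_kernel n X w c) F)"
    by (simp add: infsum_cmult_right' cinner_def)
  finally show ?thesis by (simp add: mult.commute)
qed

lemma row_mult_rmon:
  fixes F :: "'d::finite fock"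
  assumes X: "X \<in> row_ball n" and b: "b < n"
  shows "row_mult n w (mat_eval n (coeff (rmon \<beta> F)) X) b
    = (\<Sum>c<n. row_mult n w (mat_eval n (coeff F) X) c * mat_word n X \<beta> $$ (c, b))"
  using row_kernel_rmon[OF X b, of w \<beta> F] by (simp add: cinner_row_kernel[OF X] b)

lemma mat_eval_carrier [simp]: "mat_eval n c X \<in> carrier_mat n n"
  by (simp add: mat_eval_def)

lemma row_mult_unit: "a < n \<Longrightarrow> row_mult n (\<lambda>i. if i = a then 1 else 0) A b = A $$ (a, b)"
  by (simp add: row_mult_def if_distrib[of "\<lambda>x. x * _"] sum.delta cong: if_cong)

lemma mat_eval_polynomial:
  fixes q :: "'d::finite fock"
  assumes X: "X \<in> row_ball n" and q: "nc_polynomial q" and ab: "a < n" "b < n"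
  shows "mat_eval n (coeff q) X $$ (a, b) = (\<Sum>\<beta>\<in>{\<beta>. coeff q \<beta> \<noteq> 0}. coeff q \<beta> * mat_word n X \<beta> $$ (a, b))"
proof -
  let ?k = "row_kernel n X (\<lambda>i. if i = a then 1 else 0) b"
  have fin: "finite {\<beta>. coeff q \<beta> \<noteq> 0}" using q by (simp add: nc_polynomial_def)
  have "mat_eval n (coeff q) X $$ (a, b) = cinner ?k q"
    using ab by (simp add: cinner_row_kernel[OF X] row_mult_unit)
  also have "\<dots> = (\<Sum>\<beta>\<in>{\<beta>. coeff q \<beta> \<noteq> 0}. coeff q \<beta> * cnj (coeff ?k \<beta>))"
    unfolding arg_cong[OF finite_support_expand[OF fin], of "cinner ?k"]
    by (simp add: cinner_sum_right cinner_cscale_right cinner_unit_right)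
  also have "\<dots> = (\<Sum>\<beta>\<in>{\<beta>. coeff q \<beta> \<noteq> 0}. coeff q \<beta> * mat_word n X \<beta> $$ (a, b))"
    using ab by (simp add: coeff_row_kernel[OF X] row_mult_unit)
  finally show ?thesis .
qed

lemma mat_eval_rmul:
  fixes F q :: "'d::finite fock"
  assumes X: "X \<in> row_ball n" and q: "nc_polynomial q"
  shows "mat_eval n (coeff (rmul q F)) X = mat_eval n (coeff F) X * mat_eval n (coeff q) X"
proof (rule eq_matI)
  fix a b assume "a < dim_row (mat_eval n (coeff F) X * mat_eval n (coeff q) X)"
    "b < dim_col (mat_eval n (coeff F) X * mat_eval n (coeff q) X)"
  hence ab: "a < n" "b < n" by (auto simp: mat_eval_def)
  let ?w = "\<lambda>i. if i = a then 1 else 0 :: complex"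
  let ?S = "{\<beta>. coeff q \<beta> \<noteq> 0}"
  have "mat_eval n (coeff (rmul q F)) X $$ (a, b) = cinner (row_kernel n X ?w b) (rmul q F)"
    using ab by (simp add: cinner_row_kernel[OF X] row_mult_unit)
  also have "\<dots> = (\<Sum>\<beta>\<in>?S. \<Sum>c<n. mat_eval n (coeff F) X $$ (a, c) * (coeff q \<beta> * mat_word n X \<beta> $$ (c, b)))"
    using ab
    by (simp add: rmul_def cinner_sum_right cinner_cscale_right cinner_row_kernel[OF X] row_mult_rmon[OF X])
      (simp add: row_mult_unit sum_distrib_left mult_ac)
  also have "\<dots> = (\<Sum>c<n. \<Sum>\<beta>\<in>?S. mat_eval n (coeff F) X $$ (a, c) * (coeff q \<beta> * mat_word n X \<beta> $$ (c, b)))"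
    by (rule sum.swap)
  also have "\<dots> = (\<Sum>c<n. mat_eval n (coeff F) X $$ (a, c) * mat_eval n (coeff q) X $$ (c, b))"
    using ab by (simp add: mat_eval_polynomial[OF X q] sum_distrib_left)
  finally show "mat_eval n (coeff (rmul q F)) X $$ (a, b)
      = (mat_eval n (coeff F) X * mat_eval n (coeff q) X) $$ (a, b)"
    unfolding mult_mat_entry[OF mat_eval_carrier mat_eval_carrier ab] .
qed (auto simp: mat_eval_def)

text \<open>A row vector annihilating \<open>f(X)\<close> annihilates all \<open>f(X) X\<^sup>\<beta>\<close>, hence, as \<open>f\<close> is outer and evaluation
  is continuous, also the value of the constant series \<open>1\<close>. So it is zero.\<close>

lemma outer_invertible:
  fixes f :: "'d::finite fock"
  assumes f: "nc_outer f" and X: "X \<in> row_ball n"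
  obtains B where "mat_inverse (mat_eval n (coeff f) X) = Some B"
proof -
  let ?A = "mat_eval n (coeff f) X"
  have "Determinant.det ?A \<noteq> 0"
  proof
    assume "Determinant.det ?A = 0"
    hence "Determinant.det (transpose_mat ?A) = 0" by (simp add: Determinant.det_transpose[of _ n])
    then obtain v where v: "v \<in> carrier_vec n" "v \<noteq> 0\<^sub>v n" "transpose_mat ?A *\<^sub>v v = 0\<^sub>v n"
      using det_0_iff_vec_prod_zero[of "transpose_mat ?A" n] by auto
    let ?w = "vec_index v"
    have zero: "row_mult n ?w ?A b = 0" if "b < n" for b
    proof -
      have "row_mult n ?w ?A b = vec_index (transpose_mat ?A *\<^sub>v v) b"
        using that v(1)
        by (simp add: row_mult_def scalar_prod_def atLeast0LessThan mat_eval_def mult.commute)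
      thus ?thesis using v(3) that by simp
    qed
    have "?w b = 0" if b: "b < n" for b
    proof -
      have "cinner (row_kernel n X ?w b) (rmon \<beta> f) = 0" for \<beta>
        using b by (simp add: cinner_row_kernel[OF X] row_mult_rmon[OF X] zero)
      hence "cinner (row_kernel n X ?w b) vacuum = 0" by (rule outer_functional_eq_0[OF f])
      hence "cinner vacuum (row_kernel n X ?w b) = 0" by (subst cinner_commute) simp
      thus ?thesis
        using b by (simp add: vacuum_eq_unit cinner_unit_left coeff_row_kernel[OF X] row_mult_def
            if_distrib sum.delta cong: if_cong)
    qed
    hence "v = 0\<^sub>v n" using v(1) by (intro eq_vecI) auto
    thus False using v(2) by simp
  qed
  hence "?A \<in> Units (ring_mat TYPE(complex) n ())" by (intro det_non_zero_imp_unit) auto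
  hence "mat_inverse ?A \<noteq> None" using mat_inverse(1)[of ?A n "()"] by auto
  thus ?thesis using that by auto
qed

lemma mat_annihilates_iff:
  fixes F :: "'d::finite fock"
  assumes X: "X \<in> row_ball n" and y: "y \<in> carrier_vec n"
  shows "mat_annihilates n F X y \<longleftrightarrow> (\<forall>b<n. cinner (row_kernel n X (\<lambda>a. cnj (vec_index y a)) b) F = 0)"
proof -
  let ?A = "mat_eval n (coeff F) X" and ?w = "\<lambda>a. cnj (vec_index y a)"
  have form: "mat_form y ?A v = (\<Sum>b<n. row_mult n ?w ?A b * vec_index v b)" if v: "v \<in> carrier_vec n" for v
  proof -
    have "mat_form y ?A v = (\<Sum>a<n. (\<Sum>b<n. ?A $$ (a, b) * vec_index v b) * ?w a)"
      using v y by (simp add: mat_form_def scalar_prod_def atLeast0LessThan mat_eval_def conjugate_complex_def)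
    also have "\<dots> = (\<Sum>a<n. \<Sum>b<n. ?w a * ?A $$ (a, b) * vec_index v b)"
      by (simp add: sum_distrib_left sum_distrib_right mult_ac)
    also have "\<dots> = (\<Sum>b<n. \<Sum>a<n. ?w a * ?A $$ (a, b) * vec_index v b)" by (rule sum.swap)
    finally show ?thesis by (simp add: row_mult_def sum_distrib_right)
  qed
  have "mat_annihilates n F X y \<longleftrightarrow> (\<forall>b<n. row_mult n ?w ?A b = 0)"
  proof
    assume ann: "mat_annihilates n F X y"
    show "\<forall>b<n. row_mult n ?w ?A b = 0"
    proof (intro allI impI)
      fix b assume b: "b < n"
      have "mat_form y ?A (unit_vec n b) = row_mult n ?w ?A b"
        using b by (simp add: form if_distrib sum.delta cong: if_cong)
      thus "row_mult n ?w ?A b = 0" using ann by (simp add: mat_annihilates_def)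
    qed
  qed (simp add: mat_annihilates_def form)
  thus ?thesis using cinner_row_kernel[OF X] by auto
qed

lemma (in isometric_multiplier) mat_annihilates_range:
  assumes X: "X \<in> row_ball n" and y: "y \<in> carrier_vec n" and ann: "mat_annihilates n \<Theta> X y"
  shows "mat_annihilates n (blinfun_apply T g) X y"
  unfolding mat_annihilates_iff[OF X y]
  using ann[unfolded mat_annihilates_iff[OF X y]]
  by (auto intro!: range_functional_eq_0 simp: row_kernel_rmon[OF X])

subsection \<open>Operator points\<close>

lemma op_word_append: "op_word X (\<alpha> @ \<beta>) = op_word X \<alpha> o\<^sub>L op_word X \<beta>"
  by (induction \<alpha>) (auto intro!: blinfun_eqI)

lemma op_word_cscale:
  assumes "range X \<subseteq> bounded_ops"
  shows "blinfun_apply (op_word X \<alpha>) (cscale c v) = cscale c (blinfun_apply (op_word X \<alpha>) v)"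
  using assms by (induction \<alpha>) (auto simp: bounded_ops_def image_subset_iff)

lemma adjoint_row_contraction:
  assumes "range X \<subseteq> bounded_ops"
  shows "(\<Sum>j\<in>UNIV. (norm (blinfun_apply (op_adjoint (X j)) y))\<^sup>2)
    \<le> norm (\<Sum>j\<in>UNIV. X j o\<^sub>L op_adjoint (X j)) * (norm y)\<^sup>2"
proof -
  let ?G = "\<Sum>j\<in>UNIV. X j o\<^sub>L op_adjoint (X j)"
  have X: "X j \<in> bounded_ops" for j using assms by auto
  have "of_real (\<Sum>j\<in>UNIV. (norm (blinfun_apply (op_adjoint (X j)) y))\<^sup>2)
      = (\<Sum>j\<in>UNIV. cinner (blinfun_apply (op_adjoint (X j)) y) (blinfun_apply (op_adjoint (X j)) y))"
    by (simp add: cinner_self)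
  also have "\<dots> = cinner y (blinfun_apply ?G y)"
    unfolding op_adjoint[OF X] by (simp add: blinfun.sum_left cinner_sum_right)
  finally have "\<bar>\<Sum>j\<in>UNIV. (norm (blinfun_apply (op_adjoint (X j)) y))\<^sup>2\<bar> = cmod (cinner y (blinfun_apply ?G y))"
    by (rule abs_eq_cmod)
  also have "\<dots> \<le> norm y * (norm ?G * norm y)"
    by (rule order_trans[OF cinner_bound]) (intro mult_left_mono norm_blinfun norm_ge_zero)
  finally show ?thesis by (simp add: power2_eq_square mult_ac)
qed

text \<open>As for matrices, splitting off the first letter of the word replaces \<open>y\<close> by \<open>X\<^sub>j\<^sup>* y\<close>.\<close>

lemma op_power_contraction:
  fixes X :: "'d::finite \<Rightarrow> nat ell2 \<Rightarrow>\<^sub>L nat ell2"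
  assumes X: "range X \<subseteq> bounded_ops" and \<rho>: "norm (\<Sum>j\<in>UNIV. X j o\<^sub>L op_adjoint (X j)) \<le> \<rho>"
  shows "(\<Sum>\<alpha> | length \<alpha> = k. (cmod (cinner y (blinfun_apply (op_word X \<alpha>) v)))\<^sup>2)
    \<le> (norm y)\<^sup>2 * (norm v)\<^sup>2 * \<rho> ^ k"
proof (induction k arbitrary: y)
  case 0
  show ?case using cinner_bound[of y v] by (simp add: power_mult_distrib[symmetric] power_mono)
next
  case (Suc k)
  let ?S = "\<lambda>j. blinfun_apply (op_adjoint (X j)) y"
  have \<rho>0: "\<rho> \<ge> 0" using \<rho> norm_ge_zero order_trans by blast
  have adj: "cinner y (blinfun_apply (X j) x) = cinner (?S j) x" for j x
    using X by (subst op_adjoint) auto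
  have "(\<Sum>\<alpha> | length \<alpha> = Suc k. (cmod (cinner y (blinfun_apply (op_word X \<alpha>) v)))\<^sup>2)
      = (\<Sum>j\<in>UNIV. \<Sum>\<alpha> | length \<alpha> = k. (cmod (cinner (?S j) (blinfun_apply (op_word X \<alpha>) v)))\<^sup>2)"
    by (simp add: sum_words_Suc adj)
  also have "\<dots> \<le> (\<Sum>j\<in>UNIV. (norm (?S j))\<^sup>2 * (norm v)\<^sup>2 * \<rho> ^ k)"
    by (intro sum_mono Suc.IH)
  also have "\<dots> = (\<Sum>j\<in>UNIV. (norm (?S j))\<^sup>2) * ((norm v)\<^sup>2 * \<rho> ^ k)"
    by (simp add: sum_distrib_right mult.assoc)
  also have "\<dots> \<le> (\<rho> * (norm y)\<^sup>2) * ((norm v)\<^sup>2 * \<rho> ^ k)"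
  proof (rule mult_right_mono)
    show "(\<Sum>j\<in>UNIV. (norm (?S j))\<^sup>2) \<le> \<rho> * (norm y)\<^sup>2"
      using adjoint_row_contraction[OF X, of y] mult_right_mono[OF \<rho>, of "(norm y)\<^sup>2"] by simp
  qed (use \<rho>0 in simp)
  finally show ?case by (simp add: mult_ac)
qed

text \<open>The vector representing the functional \<open>F \<mapsto> \<langle>y, F(X) v\<rangle>\<close>.\<close>

definition op_kernel :: "('d \<Rightarrow> nat ell2 \<Rightarrow>\<^sub>L nat ell2) \<Rightarrow> nat ell2 \<Rightarrow> nat ell2 \<Rightarrow> 'd fock" where
  "op_kernel X y v = Abs_ell2 (\<lambda>\<alpha>. cnj (cinner y (blinfun_apply (op_word X \<alpha>) v)))"

lemma coeff_op_kernel: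
  fixes X :: "'d::finite \<Rightarrow> nat ell2 \<Rightarrow>\<^sub>L nat ell2"
  assumes "X \<in> row_ball_inf"
  shows "coeff (op_kernel X y v) \<alpha> = cnj (cinner y (blinfun_apply (op_word X \<alpha>) v))"
  unfolding op_kernel_def
proof (rule coeff_Abs, rule sq_summable_geometric)
  let ?\<rho> = "norm (\<Sum>j\<in>UNIV. X j o\<^sub>L op_adjoint (X j))"
  show "(\<Sum>\<alpha> | length \<alpha> = k. (cmod (cnj (cinner y (blinfun_apply (op_word X \<alpha>) v))))\<^sup>2)
      \<le> (norm y)\<^sup>2 * (norm v)\<^sup>2 * ?\<rho> ^ k" for k
    using op_power_contraction[of X ?\<rho> y v k] assms by (simp add: row_ball_inf_def)
qed (use assms in \<open>auto simp: row_ball_inf_def\<close>)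

text \<open>Testing the \<open>k\<close>-th homogeneous part \<open>A\<^sub>k v\<close> against itself and using the Cauchy-Schwarz inequality over
  the words of length \<open>k\<close> bounds its norm by a geometric sequence.\<close>

lemma op_eval_summable:
  fixes X :: "'d::finite \<Rightarrow> nat ell2 \<Rightarrow>\<^sub>L nat ell2"
  assumes "X \<in> row_ball_inf"
  shows "summable (\<lambda>k. \<Sum>\<alpha> | length \<alpha> = k. cscaleL (coeff F \<alpha>) o\<^sub>L op_word X \<alpha>)"
proof (rule summable_comparison_test)
  let ?\<rho> = "norm (\<Sum>j\<in>UNIV. X j o\<^sub>L op_adjoint (X j))"
  let ?A = "\<lambda>k. \<Sum>\<alpha> | length \<alpha> = k. cscaleL (coeff F \<alpha>) o\<^sub>L op_word X \<alpha>"
  have X: "range X \<subseteq> bounded_ops" and \<rho>: "?\<rho> < 1" using assms by (auto simp: row_ball_inf_def)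
  have "norm (?A k) \<le> norm F * sqrt ?\<rho> ^ k" for k
  proof (rule norm_blinfun_bound)
    fix v
    let ?y = "blinfun_apply (?A k) v"
    let ?c = "\<lambda>\<alpha>. cinner ?y (blinfun_apply (op_word X \<alpha>) v)"
    have app: "blinfun_apply (?A k) w = (\<Sum>\<alpha> | length \<alpha> = k. cscale (coeff F \<alpha>) (blinfun_apply (op_word X \<alpha>) w))"
      for w by (simp add: blinfun.sum_left cscaleL.rep_eq)
    have "cinner z ?y = (\<Sum>\<alpha> | length \<alpha> = k. coeff F \<alpha> * cinner z (blinfun_apply (op_word X \<alpha>) v))" for z
      unfolding app cinner_sum_right cinner_cscale_right ..
    with cinner_self[of ?y] have "of_real ((norm ?y)\<^sup>2) = (\<Sum>\<alpha> | length \<alpha> = k. coeff F \<alpha> * ?c \<alpha>)"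
      by (simp only:)
    hence "\<bar>(norm ?y)\<^sup>2\<bar> = cmod (\<Sum>\<alpha> | length \<alpha> = k. coeff F \<alpha> * ?c \<alpha>)"
      by (rule abs_eq_cmod)
    hence "(norm ?y)\<^sup>2 \<le> (\<Sum>\<alpha> | length \<alpha> = k. \<bar>cmod (coeff F \<alpha>)\<bar> * \<bar>cmod (?c \<alpha>)\<bar>)"
      using norm_sum[of "\<lambda>\<alpha>. coeff F \<alpha> * ?c \<alpha>" "{\<alpha>. length \<alpha> = k}"] by (simp add: norm_mult)
    also have "\<dots> \<le> L2_set (\<lambda>\<alpha>. cmod (coeff F \<alpha>)) {\<alpha>. length \<alpha> = k} * L2_set (\<lambda>\<alpha>. cmod (?c \<alpha>)) {\<alpha>. length \<alpha> = k}"
      by (rule L2_set_mult_ineq)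
    also have "\<dots> \<le> norm F * (norm ?y * norm v * sqrt ?\<rho> ^ k)"
    proof (rule mult_mono)
      show "L2_set (\<lambda>\<alpha>. cmod (coeff F \<alpha>)) {\<alpha>. length \<alpha> = k} \<le> norm F"
        unfolding L2_set_def
        by (rule real_le_lsqrt) (auto intro: sum_coeff_le_norm finite_words_length)
      have "L2_set (\<lambda>\<alpha>. cmod (?c \<alpha>)) {\<alpha>. length \<alpha> = k} \<le> sqrt ((norm ?y)\<^sup>2 * (norm v)\<^sup>2 * ?\<rho> ^ k)"
        unfolding L2_set_def by (intro real_sqrt_le_mono op_power_contraction X order_refl)
      also have "\<dots> = norm ?y * norm v * sqrt ?\<rho> ^ k"
        by (simp add: real_sqrt_mult real_sqrt_power)
      finally show "L2_set (\<lambda>\<alpha>. cmod (?c \<alpha>)) {\<alpha>. length \<alpha> = k} \<le> norm ?y * norm v * sqrt ?\<rho> ^ k" .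
    qed auto
    finally have "norm ?y * norm ?y \<le> norm ?y * (norm F * sqrt ?\<rho> ^ k * norm v)"
      by (simp add: power2_eq_square mult_ac)
    thus "norm ?y \<le> norm F * sqrt ?\<rho> ^ k * norm v"
      by (cases "norm ?y = 0") (auto dest: mult_left_le_imp_le)
  qed simp
  thus "\<exists>N. \<forall>k\<ge>N. norm (?A k) \<le> norm F * sqrt ?\<rho> ^ k" by blast
  show "summable (\<lambda>k. norm F * sqrt ?\<rho> ^ k)"
    using \<rho> by (intro summable_mult summable_geometric) simp
qed

lemma cinner_op_eval:
  fixes X :: "'d::finite \<Rightarrow> nat ell2 \<Rightarrow>\<^sub>L nat ell2"
  assumes X: "X \<in> row_ball_inf"
  shows "cinner y (blinfun_apply (op_eval (coeff F) X) v) = cinner (op_kernel X y v) F"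
proof -
  have "(\<lambda>k. cinner y (blinfun_apply (\<Sum>\<alpha> | length \<alpha> = k. cscaleL (coeff F \<alpha>) o\<^sub>L op_word X \<alpha>) v))
      sums cinner y (blinfun_apply (op_eval (coeff F) X) v)"
    unfolding op_eval_def
    by (intro bounded_linear.sums[OF bounded_linear_cinner]
        bounded_linear.sums[OF blinfun.bounded_linear_left] summable_sums op_eval_summable X)
  moreover have "cinner y (blinfun_apply (\<Sum>\<alpha> | length \<alpha> = k. cscaleL (coeff F \<alpha>) o\<^sub>L op_word X \<alpha>) v)
      = (\<Sum>\<alpha> | length \<alpha> = k. cnj (coeff (op_kernel X y v) \<alpha>) * coeff F \<alpha>)" for k
    by (simp add: blinfun.sum_left cinner_sum_right cscaleL.rep_eq cinner_cscale_right
        coeff_op_kernel[OF X] mult.commute)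
  ultimately show ?thesis
    using sums_unique2[OF _ cinner_sums_by_length[of "op_kernel X y v" F]] by simp
qed

lemma op_kernel_rmon:
  fixes X :: "'d::finite \<Rightarrow> nat ell2 \<Rightarrow>\<^sub>L nat ell2"
  assumes X: "X \<in> row_ball_inf"
  shows "cinner (op_kernel X y v) (rmon \<beta> F) = cinner (op_kernel X y (blinfun_apply (op_word X \<beta>) v)) F"
  unfolding cinner_rmon_expand by (simp add: cinner_def coeff_op_kernel[OF X] op_word_append)

lemma op_annihilates_iff:
  fixes X :: "'d::finite \<Rightarrow> nat ell2 \<Rightarrow>\<^sub>L nat ell2"
  assumes X: "X \<in> row_ball_inf"
  shows "op_annihilates F X y \<longleftrightarrow> (\<forall>v. cinner (op_kernel X y v) F = 0)"
  by (simp add: op_annihilates_def cinner_op_eval[OF X])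

lemma (in isometric_multiplier) op_annihilates_range:
  assumes X: "X \<in> row_ball_inf" and ann: "op_annihilates \<Theta> X y"
  shows "op_annihilates (blinfun_apply T g) X y"
  using ann unfolding op_annihilates_iff[OF X]
  by (auto intro!: range_functional_eq_0 simp: op_kernel_rmon[OF X])

section \<open>Scaled left shifts as singular points\<close>

text \<open>Transport along a bijection of the index sets: the Fock space is indexed by words, the operators at
  the infinite level act on sequences indexed by natural numbers.\<close>

definition relabel :: "('j \<Rightarrow> 'i) \<Rightarrow> 'i ell2 \<Rightarrow> 'j ell2" where
  "relabel h x = Abs_ell2 (\<lambda>j. coeff x (h j))"

context
  fixes h :: "'j \<Rightarrow> 'i"
  assumes h: "bij h"
begin

lemma coeff_relabel [simp]: "coeff (relabel h x) j = coeff x (h j)"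
proof -
  have "(\<lambda>j. (cmod (coeff x (h j)))\<^sup>2) summable_on UNIV"
    using summable_coeff[of x] summable_on_reindex_bij_betw[OF h, of "\<lambda>i. (cmod (coeff x i))\<^sup>2"]
    by simp
  thus ?thesis unfolding relabel_def by (intro coeff_Abs) (simp add: sq_summable_def)
qed

lemma norm_relabel: "norm (relabel h x) = norm x"
  using infsum_reindex_bij_betw[OF h, of "\<lambda>i. (cmod (coeff x i))\<^sup>2"] by (simp add: norm_ell2_eq)

lemma cinner_relabel: "cinner (relabel h x) (relabel h y) = cinner x y"
  using infsum_reindex_bij_betw[OF h, of "\<lambda>i. cnj (coeff x i) * coeff y i"] by (simp add: cinner_def)

end

lemma Lfun_unit: "Lfun k (unit \<gamma>) = unit (k # \<gamma>)"
proof (rule ell2_eqI)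
  fix \<alpha> show "coeff (Lfun k (unit \<gamma>)) \<alpha> = coeff (unit (k # \<gamma>)) \<alpha>"
    by (cases \<alpha>) (auto simp: Lfun.rep_eq coeff_unit)
qed

lemma cinner_bshift: "cinner (bshift k x) y = cinner x (Lfun k y)"
proof -
  have inj: "inj ((#) k)" by auto
  have "cinner x (Lfun k y) = (\<Sum>\<^sub>\<infinity>\<gamma>\<in>range ((#) k). cnj (coeff x \<gamma>) * coeff (Lfun k y) \<gamma>)"
    unfolding cinner_def by (rule infsum_cong_neutral) (auto simp: Lfun.rep_eq image_iff neq_Nil_conv)
  also have "\<dots> = cinner (bshift k x) y"
    by (subst infsum_reindex[OF inj]) (simp add: o_def cinner_def Lfun.rep_eq)
  finally show ?thesis ..
qed

lemma norm_bshift_le: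
  fixes F :: "'d::finite fock"
  shows "norm (bshift k F) \<le> norm F"
proof -
  have "(norm (bshift k F))\<^sup>2 \<le> (\<Sum>k\<in>UNIV. (norm (bshift k F))\<^sup>2)"
    by (rule member_le_sum) auto
  also have "\<dots> = (norm (tail (Suc 0) F))\<^sup>2" by (simp add: tail_Suc)
  also have "\<dots> \<le> (norm F)\<^sup>2"
    using norm_tail_antimono[of 0 "Suc 0" F] by (intro power_mono) auto
  finally show ?thesis by simp
qed

text \<open>If \<open>D\<^sub>r u\<close>, with coefficients \<open>r\<^sup>|\<^sup>\<alpha>\<^sup>|u\<^sub>\<alpha>\<close>, is square-summable for some \<open>r > 1\<close>, then the strict row
  contraction \<open>Z = r\<^sup>-\<^sup>1L\<close> and the vector \<open>y = D\<^sub>r u\<close>, transported to sequences indexed by natural numbers,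
  satisfy \<open>\<langle>y, F(Z) z\<^sup>\<beta>\<rangle> = r\<^sup>|\<^sup>\<beta>\<^sup>|\<langle>u, F z\<^sup>\<beta>\<rangle>\<close>: the scaling of the vector undoes the scaling of the
  shifts.\<close>

lemma decaying_vector_point:
  fixes u :: "'d::finite fock"
  assumes r: "r > 1" and u: "decays r u"
  obtains Z y where "Z \<in> row_ball_inf" "y = 0 \<Longrightarrow> u = 0"
    "\<And>F. op_annihilates F Z y \<longleftrightarrow> (\<forall>\<beta>. cinner u (rmon \<beta> F) = 0)"
proof -
  define d :: "nat \<Rightarrow> 'd list" where "d = from_nat_into UNIV"
  have d: "bij d" unfolding d_def
    using bij_betw_from_nat_into[of "UNIV :: 'd list set"] by (simp add: infinite_UNIV_listI)
  define e where "e = inv_into UNIV d"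
  have e: "bij e" unfolding e_def by (rule bij_imp_bij_inv[OF d])
  have de [simp]: "d (e \<beta>) = \<beta>" for \<beta> unfolding e_def by (rule surj_f_inv_f[OF bij_is_surj[OF d]])
  have ed [simp]: "e (d i) = i" for i unfolding e_def by (rule inv_f_f[OF bij_is_inj[OF d]])
  define s where "s = 1 / r"
  have s: "0 < s" "s < 1" "s * r = 1" using r by (auto simp: s_def)
  define U :: "'d fock \<Rightarrow> nat ell2" where "U = relabel d"
  define V :: "nat ell2 \<Rightarrow> 'd fock" where "V = relabel e"
  have cU [simp]: "coeff (U x) i = coeff x (d i)" for x i by (simp add: U_def coeff_relabel[OF d])
  have cV [simp]: "coeff (V x) \<beta> = coeff x (e \<beta>)" for x \<beta> by (simp add: V_def coeff_relabel[OF e])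
  have nU: "norm (U x) = norm x" for x by (simp add: U_def norm_relabel[OF d])
  have nV: "norm (V x) = norm x" for x by (simp add: V_def norm_relabel[OF e])
  have cinU: "cinner (U x) (U y) = cinner x y" for x y by (simp add: U_def cinner_relabel[OF d])
  have UV [simp]: "U (V x) = x" for x by (rule ell2_eqI) simp
  have VU [simp]: "V (U x) = x" for x by (rule ell2_eqI) simp
  define Z where "Z k = Blinfun (\<lambda>x. s *\<^sub>R U (Lfun k (V x)))" for k
  define S where "S k = Blinfun (\<lambda>x. s *\<^sub>R U (bshift k (V x)))" for k
  have Z: "blinfun_apply (Z k) x = s *\<^sub>R U (Lfun k (V x))" for k x
    unfolding Z_def
    by (subst bounded_linear_Blinfun_apply, rule bounded_linear_intro[where K = s])
      (use s in \<open>auto intro!: ell2_eqI simp: nU nV norm_Lfun Lfun.rep_eq algebra_simps\<close>)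
  have nB: "norm (bshift k (V x)) \<le> norm x" for k x
    using norm_bshift_le[of k "V x"] by (simp add: nV)
  have S: "blinfun_apply (S k) x = s *\<^sub>R U (bshift k (V x))" for k x
    unfolding S_def
    by (subst bounded_linear_Blinfun_apply, rule bounded_linear_intro[where K = s])
      (use s nB in \<open>auto intro!: ell2_eqI simp: nU algebra_simps\<close>)
  have "Z k \<in> bounded_ops" for k
    by (auto simp: bounded_ops_def Z Lfun.rep_eq intro!: ell2_eqI)
  hence bounded: "range Z \<subseteq> bounded_ops" by blast
  have adj: "op_adjoint (Z k) = S k" for k
  proof (rule op_adjoint_eqI)
    fix x y
    have "cinner (blinfun_apply (S k) x) y = of_real s * cinner (U (bshift k (V x))) (U (V y))"
      by (simp add: S cinner_cscale_left flip: cscale_of_real)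
    also have "\<dots> = of_real s * cinner (U (V x)) (U (Lfun k (V y)))"
      unfolding cinU cinner_bshift ..
    finally show "cinner (blinfun_apply (S k) x) y = cinner x (blinfun_apply (Z k) y)"
      by (simp add: Z cinner_scaleR_right)
  qed
  have ZS: "blinfun_apply (\<Sum>k\<in>UNIV. Z k o\<^sub>L S k) x = (s * s) *\<^sub>R U (tail (Suc 0) (V x))" for x
  proof (rule ell2_eqI)
    fix i
    have "coeff (blinfun_apply (\<Sum>k\<in>UNIV. Z k o\<^sub>L S k) x) i
        = of_real (s * s) * coeff (\<Sum>k\<in>UNIV. Lfun k (bshift k (V x))) (d i)"
      by (simp add: blinfun.sum_left Z S Lfun.rep_eq sum_distrib_left if_distrib mult.assoc cong: if_cong)
    thus "coeff (blinfun_apply (\<Sum>k\<in>UNIV. Z k o\<^sub>L S k) x) i = coeff ((s * s) *\<^sub>R U (tail (Suc 0) (V x))) i"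
      by (simp add: tail_Suc_expand)
  qed
  have "norm (\<Sum>k\<in>UNIV. Z k o\<^sub>L S k) \<le> s * s"
  proof (rule norm_blinfun_bound)
    show "norm (blinfun_apply (\<Sum>k\<in>UNIV. Z k o\<^sub>L S k) x) \<le> s * s * norm x" for x
      using norm_tail_antimono[of 0 "Suc 0" "V x"] s
      by (simp add: ZS nU nV mult_left_mono)
  qed simp
  also have "\<dots> < 1" using mult_strict_mono[of s 1 s 1] s by simp
  finally have ball: "Z \<in> row_ball_inf" using bounded by (simp add: row_ball_inf_def adj)
  define w where "w = Abs_ell2 (\<lambda>\<alpha>. of_real (r ^ length \<alpha>) * coeff u \<alpha>)"
  have w: "coeff w \<alpha> = of_real (r ^ length \<alpha>) * coeff u \<alpha>" for \<alpha>
    unfolding w_def using u by (intro coeff_Abs) (simp add: decays_def)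
  have word: "blinfun_apply (op_word Z \<alpha>) (U (unit \<beta>)) = s ^ length \<alpha> *\<^sub>R U (unit (\<alpha> @ \<beta>))" for \<alpha> \<beta>
  proof (induction \<alpha>)
    case (Cons k \<alpha>)
    have "Lfun k (V (U (unit (\<alpha> @ \<beta>)))) = unit (k # \<alpha> @ \<beta>)" by (simp add: Lfun_unit)
    thus ?case using Cons by (simp add: blinfun.scaleR_right Z)
  qed simp
  have pair: "cinner (op_kernel Z (U w) (U (unit \<beta>))) F = of_real (r ^ length \<beta>) * cinner u (rmon \<beta> F)" for \<beta> F
  proof -
    have "cinner (U w) (blinfun_apply (op_word Z \<alpha>) (U (unit \<beta>)))
        = of_real (r ^ length \<beta>) * cnj (coeff u (\<alpha> @ \<beta>))" for \<alpha>
    proof -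
      have "s ^ length \<alpha> * r ^ length (\<alpha> @ \<beta>) = r ^ length \<beta>"
        using s(3) by (simp add: power_add power_mult_distrib[symmetric] mult.assoc[symmetric])
      hence "of_real (s ^ length \<alpha>) * of_real (r ^ length (\<alpha> @ \<beta>)) = (of_real (r ^ length \<beta>) :: complex)"
        by (metis of_real_mult)
      thus ?thesis
        by (simp only: word cinner_scaleR_right cinU cinner_unit_right w complex_cnj_mult
            complex_cnj_complex_of_real mult.assoc[symmetric])
    qed
    thus ?thesis
      by (simp add: cinner_def[of "op_kernel Z (U w) (U (unit \<beta>))"] cinner_rmon_expand
          coeff_op_kernel[OF ball] mult.assoc infsum_cmult_right')
  qed
  have ann: "op_annihilates F Z (U w) \<longleftrightarrow> (\<forall>\<beta>. cinner u (rmon \<beta> F) = 0)" for F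
  proof
    assume "op_annihilates F Z (U w)"
    hence "of_real (r ^ length \<beta>) * cinner u (rmon \<beta> F) = 0" for \<beta>
      by (simp only: op_annihilates_iff[OF ball] pair[symmetric])
    thus "\<forall>\<beta>. cinner u (rmon \<beta> F) = 0" using r by simp
  next
    assume *: "\<forall>\<beta>. cinner u (rmon \<beta> F) = 0"
    have unitU: "unit i = U (unit (d i))" for i
      using d by (intro ell2_eqI) (auto simp: coeff_unit bij_is_inj inj_eq)
    show "op_annihilates F Z (U w)"
      unfolding op_annihilates_def
    proof
      fix v
      show "cinner (U w) (blinfun_apply (op_eval (coeff F) Z) v) = 0"
      proof (rule bounded_linear_eqI[where x = v and B = "\<lambda>_. 0"])
        show "bounded_linear (\<lambda>v. cinner (U w) (blinfun_apply (op_eval (coeff F) Z) v))"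
          by (rule bounded_linear_compose[OF bounded_linear_cinner blinfun.bounded_linear_right])
        fix c i
        have "op_kernel Z (U w) (cscale c (unit i)) = cscale (cnj c) (op_kernel Z (U w) (unit i))"
          by (rule ell2_eqI) (simp add: coeff_op_kernel[OF ball] op_word_cscale[OF bounded] cinner_cscale_right)
        thus "cinner (U w) (blinfun_apply (op_eval (coeff F) Z) (cscale c (unit i))) = 0"
          using * pair[of "d i" F] by (simp add: cinner_op_eval[OF ball] cinner_cscale_left unitU[of i])
      qed simp
    qed
  qed
  have nonzero: "u = 0" if "U w = 0"
  proof (rule ell2_eqI)
    fix \<alpha>
    have "coeff (U w) (e \<alpha>) = 0" using that by simp
    thus "coeff u \<alpha> = coeff 0 \<alpha>" using r by (simp add: w)
  qed
  show ?thesis by (rule that[OF ball nonzero ann])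
qed

text \<open>If the coefficients of \<open>\<Theta>\<close> decay, so do those of \<open>u = x - T T\<^sup>* x\<close> for polynomials \<open>x\<close>, since \<open>T\<^sup>* x\<close> is
  a polynomial. As \<open>u\<close> is orthogonal to the range of \<open>T\<close>, the point that belongs to \<open>u\<close> is a singular point of
  \<open>\<Theta>\<close>, and the hypothesis on \<open>h\<close> at that point says that \<open>u\<close> is orthogonal to \<open>h\<close>.\<close>

lemma (in isometric_multiplier) decaying_blaschke_range:
  assumes r: "r > 1" and decay: "decays r \<Theta>"
    and h: "\<And>Z y. (Z, y) \<in> Sing_inf \<Theta> \<Longrightarrow> op_annihilates h Z y"
  shows "h \<in> range (blinfun_apply T)"
proof (rule mem_rangeI)
  fix x g assume x: "nc_polynomial x" and g: "nc_polynomial g"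
    and orth: "\<And>F. cinner (x - blinfun_apply T g) (blinfun_apply T F) = 0"
  let ?u = "x - blinfun_apply T g"
  have "decays r ?u"
    unfolding T_rmul[OF g] by (intro decays_diff decays_polynomial x decays_rmul decay)
  then obtain Z y where Z: "Z \<in> row_ball_inf" "y = 0 \<Longrightarrow> ?u = 0"
    "\<And>F. op_annihilates F Z y \<longleftrightarrow> (\<forall>\<beta>. cinner ?u (rmon \<beta> F) = 0)"
    using decaying_vector_point[OF r] by blast
  show "cinner ?u h = 0"
  proof (cases "?u = 0")
    case False
    have "op_annihilates \<Theta> Z y"
      unfolding Z(3) using orth[of "unit _"] by (simp add: T_unit)
    hence "(Z, y) \<in> Sing_inf \<Theta>" using Z(1,2) False by (auto simp: Sing_inf_def)
    hence "op_annihilates h Z y" by (rule h)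
    hence "cinner ?u (rmon [] h) = 0" unfolding Z(3) by blast
    thus ?thesis by simp
  qed simp
qed

section \<open>Noncommutative polynomials as expressions\<close>

primrec word_expr :: "'d list \<Rightarrow> 'd nc_expr" where
  "word_expr [] = Scalar 1"
| "word_expr (k # \<alpha>) = Mul (Var k) (word_expr \<alpha>)"

primrec poly_expr :: "('d list \<Rightarrow> complex) \<Rightarrow> 'd list list \<Rightarrow> 'd nc_expr" where
  "poly_expr c [] = Scalar 0"
| "poly_expr c (\<alpha> # \<alpha>s) = Add (Mul (Scalar (c \<alpha>)) (word_expr \<alpha>)) (poly_expr c \<alpha>s)"

lemma expr_eval_word:
  assumes "X \<in> mat_tuples n"
  shows "expr_eval n X (word_expr \<alpha>) = Some (mat_word n X \<alpha>)"
  by (induction \<alpha>) (auto intro!: eq_matI)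

lemma expr_eval_poly:
  assumes X: "X \<in> mat_tuples n"
  shows "\<exists>M\<in>carrier_mat n n. expr_eval n X (poly_expr c \<alpha>s) = Some M \<and>
    (\<forall>a<n. \<forall>b<n. M $$ (a, b) = (\<Sum>\<alpha>\<leftarrow>\<alpha>s. c \<alpha> * mat_word n X \<alpha> $$ (a, b)))"
proof (induction \<alpha>s)
  case Nil
  show ?case by (intro bexI[of _ "0 \<cdot>\<^sub>m 1\<^sub>m n"]) auto
next
  case (Cons \<alpha> \<alpha>s)
  then obtain M where M: "M \<in> carrier_mat n n" "expr_eval n X (poly_expr c \<alpha>s) = Some M"
    "\<And>a b. a < n \<Longrightarrow> b < n \<Longrightarrow> M $$ (a, b) = (\<Sum>\<alpha>\<leftarrow>\<alpha>s. c \<alpha> * mat_word n X \<alpha> $$ (a, b))"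
    by blast
  let ?W = "mat_word n X \<alpha>"
  have W: "?W \<in> carrier_mat n n" by (rule mat_word_carrier[OF X])
  have cW: "c \<alpha> \<cdot>\<^sub>m 1\<^sub>m n * ?W = c \<alpha> \<cdot>\<^sub>m ?W"
    using W mult_smult_assoc_mat[of "1\<^sub>m n" n n ?W n "c \<alpha>"] by simp
  have "(c \<alpha> \<cdot>\<^sub>m ?W + M) $$ (a, b) = (\<Sum>\<alpha>\<leftarrow>\<alpha> # \<alpha>s. c \<alpha> * mat_word n X \<alpha> $$ (a, b))"
    if "a < n" "b < n" for a b
    using that W M by auto
  moreover have "c \<alpha> \<cdot>\<^sub>m ?W + M \<in> carrier_mat n n" using W M(1) by auto
  moreover have "expr_eval n X (poly_expr c (\<alpha> # \<alpha>s)) = Some (c \<alpha> \<cdot>\<^sub>m ?W + M)"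
    using M(2) cW by (simp add: expr_eval_word[OF X])
  ultimately show ?case by blast
qed

lemma polynomial_expr:
  fixes q :: "'d::finite fock"
  assumes q: "nc_polynomial q"
  obtains e where "\<And>n X. X \<in> row_ball n \<Longrightarrow> expr_eval n X e = Some (mat_eval n (coeff q) X)"
proof -
  have "finite {\<alpha>. coeff q \<alpha> \<noteq> 0}" using q by (simp add: nc_polynomial_def)
  then obtain \<alpha>s where \<alpha>s: "set \<alpha>s = {\<alpha>. coeff q \<alpha> \<noteq> 0}" "distinct \<alpha>s"
    using finite_distinct_list by blast
  have "expr_eval n X (poly_expr (coeff q) \<alpha>s) = Some (mat_eval n (coeff q) X)" if X: "X \<in> row_ball n" for n X
  proof -
    have X': "X \<in> mat_tuples n" using X by (simp add: row_ball_def)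
    obtain M where M: "M \<in> carrier_mat n n" "expr_eval n X (poly_expr (coeff q) \<alpha>s) = Some M"
      "\<And>a b. a < n \<Longrightarrow> b < n \<Longrightarrow> M $$ (a, b) = (\<Sum>\<alpha>\<leftarrow>\<alpha>s. coeff q \<alpha> * mat_word n X \<alpha> $$ (a, b))"
      using expr_eval_poly[OF X', of "coeff q" \<alpha>s] by blast
    have "M = mat_eval n (coeff q) X"
    proof (rule eq_matI)
      fix a b assume "a < dim_row (mat_eval n (coeff q) X)" "b < dim_col (mat_eval n (coeff q) X)"
      hence ab: "a < n" "b < n" by (auto simp: mat_eval_def)
      show "M $$ (a, b) = mat_eval n (coeff q) X $$ (a, b)"
        unfolding M(3)[OF ab] mat_eval_polynomial[OF X q ab] \<alpha>s(1)[symmetric]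
        by (rule sum_list_distinct_conv_sum_set[OF \<alpha>s(2)])
    qed (use M(1) in \<open>auto simp: mat_eval_def\<close>)
    thus ?thesis using M(2) by simp
  qed
  thus ?thesis by (rule that)
qed

lemma zero_in_row_ball: "(\<lambda>_. 0\<^sub>m n n) \<in> row_ball n"
proof -
  have G: "row_gram n (\<lambda>_. 0\<^sub>m n n) = 0\<^sub>m n n"
  proof (rule eq_matI)
    fix a b assume "a < dim_row (0\<^sub>m n n :: complex mat)" "b < dim_col (0\<^sub>m n n :: complex mat)"
    thus "row_gram n (\<lambda>_. 0\<^sub>m n n) $$ (a, b) = 0\<^sub>m n n $$ (a, b)"
      by (subst row_gram_entry) (auto simp: mat_tuples_def)
  qed (auto simp: row_gram_def)
  have "vec_norm2 (0\<^sub>m n n *\<^sub>v v) \<le> 0" if "v \<in> carrier_vec n" for v :: "complex vec"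
  proof -
    have "0\<^sub>m n n *\<^sub>v v = 0\<^sub>v n" using that by (intro eq_vecI) (auto simp: scalar_prod_def)
    thus ?thesis by (simp add: vec_norm2_def)
  qed
  hence "mat_norm n (0\<^sub>m n n) \<le> 0"
    unfolding mat_norm_def
    by (intro cSUP_least) (auto intro!: exI[of _ "0\<^sub>v n"] simp: vec_norm2_L2_set[of _ n] L2_set_def)
  thus ?thesis by (simp add: row_ball_def mat_tuples_def G)
qed

text \<open>The expression \<open>p q\<^sup>-\<^sup>1\<close> can be evaluated on the whole row ball, so the radius \<open>1\<close> serves in the
  definition of the power series; the zero tuple shows that its domain is nonempty.\<close>

lemma quotient_rational:
  fixes p q \<Theta> :: "'d::finite fock"
  assumes p: "nc_polynomial p" and q: "nc_polynomial q"
    and quot: "\<And>n X. X \<in> row_ball n \<Longrightarrow>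
      \<exists>B. mat_inverse (mat_eval n (coeff q) X) = Some B \<and>
          mat_eval n (coeff \<Theta>) X = mat_eval n (coeff p) X * B"
  shows "nc_rational \<Theta>"
proof -
  obtain a where a: "\<And>n X. X \<in> row_ball n \<Longrightarrow> expr_eval n X a = Some (mat_eval n (coeff p) X)"
    using polynomial_expr[OF p] by blast
  obtain b where b: "\<And>n X. X \<in> row_ball n \<Longrightarrow> expr_eval n X b = Some (mat_eval n (coeff q) X)"
    using polynomial_expr[OF q] by blast
  define e where "e = Mul a (Inv b)"
  have e: "expr_eval n X e = Some (mat_eval n (coeff \<Theta>) X)" if X: "X \<in> row_ball n" for n X
    using quot[OF X] a[OF X] b[OF X] by (auto simp: e_def)
  have "(1, \<lambda>_. 0\<^sub>m 1 1) \<in> expr_dom e"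
    using e[OF zero_in_row_ball[of 1]] zero_in_row_ball[of 1] by (auto simp: expr_dom_def row_ball_def)
  hence valid: "e \<in> valid_exprs" by (auto simp: valid_exprs_def)
  hence "expr_equiv `` {e} \<in> nc_rational_functions"
    unfolding nc_rational_functions_def by (rule quotientI)
  moreover have "e \<in> expr_equiv `` {e}"
    using valid by (auto simp: expr_equiv_def valid_exprs_def)
  hence "power_series_at_0 (expr_equiv `` {e}) (coeff \<Theta>)"
    unfolding power_series_at_0_def
    by (intro bexI[of _ e] exI[of _ 1]) (auto simp: e summable_mat_term row_ball_def)
  ultimately show ?thesis unfolding nc_rational_def by blast
qed


section \<open>The inner factor of a noncommutative polynomial\<close>

theorem theorem6p1:
  fixes p \<Theta> f :: "'d::finite fock"
    and n :: nat and Z :: "'d \<Rightarrow> complex mat" and y v :: "complex vec"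
  assumes "nc_polynomial p"
    and "n \<ge> 1" and "Z \<in> row_ball n" and "y \<in> carrier_vec n" and "v \<in> carrier_vec n"
    and "p = szego_kernel n Z y v"
    and "nc_inner \<Theta>" and "nc_outer f" and "p = op_of \<Theta> f"
  shows "nc_polynomial f \<and> nc_degree f \<le> nc_degree p
    \<and> (\<forall>m\<ge>1. \<forall>X\<in>row_ball m. \<exists>B. mat_inverse (mat_eval m (coeff f) X) = Some B
          \<and> mat_eval m (coeff \<Theta>) X = mat_eval m (coeff p) X * B)
    \<and> nc_inner \<Theta> \<and> nc_rational \<Theta>
    \<and> nc_blaschke \<Theta>"
proof -
  interpret isometric_multiplier "op_of \<Theta>" \<Theta>
    by (rule nc_inner_isometric_multiplier[OF assms(7)])
  have f0: "coeff f [] \<noteq> 0" by (rule outer_constant_coeff[OF assms(8)])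
  have low: "length \<beta> \<le> nc_degree p" if "coeff f \<beta> \<noteq> 0" for \<beta>
  proof (rule ccontr)
    assume "\<not> length \<beta> \<le> nc_degree p"
    hence \<beta>: "nc_degree p < length \<beta>" by simp
    have "coeff f \<beta> = 0"
    proof (rule quotient_degree[OF _ \<beta>])
      show "coeff (blinfun_apply (op_of \<Theta>) f) \<alpha> = 0" if "nc_degree p < length \<alpha>" for \<alpha>
        unfolding assms(9)[symmetric] by (rule nc_degree_less[OF assms(1) that])
    qed
    with that show False by simp
  qed
  have "finite {\<alpha> :: 'd list. length \<alpha> \<le> nc_degree p}"
    using finite_lists_length_le[of "UNIV :: 'd set" "nc_degree p"] by simp
  hence f: "nc_polynomial f"
    unfolding nc_polynomial_def by (rule rev_finite_subset) (use low in auto)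
  have deg: "nc_degree f \<le> nc_degree p"
    unfolding nc_degree_def[of f]
  proof (rule Max.boundedI)
    show "finite (length ` {\<alpha>. coeff f \<alpha> \<noteq> 0})" using f by (simp add: nc_polynomial_def)
    show "length ` {\<alpha>. coeff f \<alpha> \<noteq> 0} \<noteq> {}" using f0 by blast
    show "k \<le> nc_degree p" if "k \<in> length ` {\<alpha>. coeff f \<alpha> \<noteq> 0}" for k using that low by blast
  qed
  have prod: "p = rmul f \<Theta>" using assms(9) T_rmul[OF f] by simp
  have quot: "\<exists>B. mat_inverse (mat_eval m (coeff f) X) = Some B \<and>
      mat_eval m (coeff \<Theta>) X = mat_eval m (coeff p) X * B" if X: "X \<in> row_ball m" for m X
  proof -
    obtain B where B: "mat_inverse (mat_eval m (coeff f) X) = Some B"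
      using outer_invertible[OF assms(8) X] by blast
    hence "mat_eval m (coeff f) X * B = 1\<^sub>m m" "B \<in> carrier_mat m m"
      using mat_inverse(2)[of "mat_eval m (coeff f) X" m B] by auto
    hence "mat_eval m (coeff p) X * B = mat_eval m (coeff \<Theta>) X"
      unfolding prod mat_eval_rmul[OF X f]
      by (simp add: assoc_mult_mat[OF mat_eval_carrier mat_eval_carrier] right_mult_one_mat[OF mat_eval_carrier])
    thus ?thesis using B by simp
  qed
  obtain r where r: "r > 1" "decays r \<Theta>"
    using rational_decays[OF f f0, of \<Theta>] assms(1) prod by auto
  have "range (blinfun_apply (op_of \<Theta>)) =
       {h. (\<forall>n\<ge>1. \<forall>(Z, y)\<in>Sing n \<Theta>. mat_annihilates n h Z y) \<and>
           (\<forall>(Z, y)\<in>Sing_inf \<Theta>. op_annihilates h Z y)}"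
  proof (intro subset_antisym subsetI)
    fix h assume "h \<in> range (blinfun_apply (op_of \<Theta>))"
    thus "h \<in> {h. (\<forall>n\<ge>1. \<forall>(Z, y)\<in>Sing n \<Theta>. mat_annihilates n h Z y) \<and>
           (\<forall>(Z, y)\<in>Sing_inf \<Theta>. op_annihilates h Z y)}"
      by (auto simp: Sing_def Sing_inf_def intro: mat_annihilates_range op_annihilates_range)
  next
    fix h assume "h \<in> {h. (\<forall>n\<ge>1. \<forall>(Z, y)\<in>Sing n \<Theta>. mat_annihilates n h Z y) \<and>
           (\<forall>(Z, y)\<in>Sing_inf \<Theta>. op_annihilates h Z y)}"
    thus "h \<in> range (blinfun_apply (op_of \<Theta>))"
      by (intro decaying_blaschke_range[OF r]) auto
  qed
  hence "nc_blaschke \<Theta>" using assms(7) by (simp add: nc_blaschke_def)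
  moreover have "nc_rational \<Theta>" by (rule quotient_rational[OF assms(1) f quot])
  ultimately show ?thesis using f deg quot assms(7) by blast
qed

end
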